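(* For a point $p\in\mathrm{Gr}(4,7)$ with Plücker coordinates $p_J$ ($J$ a $4$-subset of $[7]$), define $x_1,\dots,x_7$ by $x_1=p_{1234}p_{1256}p_{1357}p_{1467}-p_{1235}p_{1246}p_{1347}p_{1567}$, $x_2=p_{1235}p_{1246}p_{2347}p_{2567}-p_{1234}p_{1256}p_{2357}p_{2467}$, $x_3=p_{1234}p_{1356}p_{2357}p_{3467}-p_{1235}p_{1346}p_{2347}p_{3567}$, $x_4=p_{1245}p_{1346}p_{2347}p_{4567}-p_{1234}p_{1456}p_{2457}p_{3467}$, $x_5=p_{1235}p_{1456}p_{2457}p_{3567}-p_{1245}p_{1356}p_{2357}p_{4567}$, $x_6=p_{1246}p_{1356}p_{2367}p_{4567}-p_{1236}p_{1456}p_{2467}p_{3567}$, $x_7=p_{1237}p_{1457}p_{2467}p_{3567}-p_{1247}p_{1357}p_{2367}p_{4567}$. Define a vector indexed by $4$-subsets of $[8]$ by keeping $p_J$ for $J\subseteq[7]$, and, for each of the $35$ four-subsets $I\subseteq[7]$ with complement $I^c=[8]\setminus I$ (which contains $8$), setting $$p_{I^c}\;=\;\mathrm{sign}(I^c,I)\cdot\frac{p_I}{\prod_{i\in I}x_i}.$$ Then, for general $p$, this vector is a point of $\mathrm{SGr}(4,8)$, and modulo the torus $(K^* )^8$ these $35$ formulas realize the Cayley octad map $\gamma:\mathcal{R}(4,7)\to\mathcal{S}(4)$.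
   Context: $\mathrm{Gr}(n,m)$ denotes the Grassmannian with Plücker coordinates $p_I$; $\mathrm{sign}(A,B)$ for disjoint increasing sequences $A,B$ with $A\cup B=[8]$ is the sign of the permutation taking $(1,\dots,8)$ to the concatenation $(A,B)$. The torus $(K^* )^{m}$ acts by $p_{i_1\cdots i_n}\mapsto\lambda_{i_1}\cdots\lambda_{i_n}p_{i_1\cdots i_n}$. The Hodge star on $\mathrm{Gr}(4,8)$ is $p^*_{I^c}=\mathrm{sign}(I,I^c)p_I$; a point $p$ is self-dual if $p^*=\lambda p$ for some $\lambda\in(K^* )^8$, and $\mathrm{SGr}(4,8)$ is the variety of self-dual points. $\mathcal{R}(4,7)$ is the space of configurations of $7$ points in $\mathbb{P}^3$ with all Plücker coordinates nonzero, modulo the torus (i.e. modulo projective transformations), and $\mathcal{S}(4)$ is the space of self-dual configurations of $8$ points in $\mathbb{P}^3$ with all Plücker coordinates nonzero modulo $(K^* )^8$; these are Cayley octads (the $8$ intersection points of three quadrics in $\mathbb{P}^3$). The Cayley octad map $\gamma:\mathcal{R}(4,7)\to\mathcal{S}(4)$ is the birational isomorphism sending a general configuration of seven points in $\mathbb{P}^3$ to the unique Cayley octad containing them. *)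

theory Defs
  imports "Jordan_Normal_Form.Determinant" "HOL-Combinatorics.Permutations"
begin

text \<open>
  Points of projective space with coordinates indexed by the \<open>n\<close>-subsets of
  \<open>{1..m}\<close> are given by coordinate vectors of type \<open>nat set \<Rightarrow> 'a\<close>, zero outside these subsets.
  All coordinates are homogeneous, and sets of points are represented by their cones.
\<close>

type_synonym 'a coords = "nat set \<Rightarrow> 'a"

definition proj_eq :: "'a::field coords \<Rightarrow> 'a coords \<Rightarrow> bool" where
  "proj_eq p q \<longleftrightarrow> (\<exists>c. c \<noteq> 0 \<and> q = (\<lambda>I. c * p I))"

subsection \<open>Grassmannians\<close>

text \<open>Point \<open>i \<in> {1..m}\<close> of the configuration is column \<open>i - 1\<close> of the matrix.\<close>

definition plucker :: "nat \<Rightarrow> nat \<Rightarrow> 'a::field mat \<Rightarrow> 'a coords" where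
  "plucker n m A I =
     (if I \<subseteq> {1..m} \<and> card I = n
      then det (mat n n (\<lambda>(i, j). A $$ (i, sorted_list_of_set I ! j - 1)))
      else 0)"

text \<open>A nonzero Plucker vector means that the matrix has rank \<open>n\<close>.\<close>

definition Gr :: "nat \<Rightarrow> nat \<Rightarrow> 'a::field coords set" where
  "Gr n m = {plucker n m A | A. A \<in> carrier_mat n m \<and> (\<exists>I. plucker n m A I \<noteq> 0)}"

definition all_nonzero :: "nat \<Rightarrow> nat \<Rightarrow> 'a::field coords \<Rightarrow> bool" where
  "all_nonzero n m p \<longleftrightarrow> (\<forall>I. I \<subseteq> {1..m} \<and> card I = n \<longrightarrow> p I \<noteq> 0)"

subsection \<open>Torus action and Hodge star\<close>

definition torus :: "nat \<Rightarrow> (nat \<Rightarrow> 'a::field) set" where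
  "torus m = {l. \<forall>i\<in>{1..m}. l i \<noteq> 0}"

definition torus_act :: "(nat \<Rightarrow> 'a::field) \<Rightarrow> 'a coords \<Rightarrow> 'a coords" where
  "torus_act l p = (\<lambda>I. (\<Prod>i\<in>I. l i) * p I)"

definition torus_orbit :: "nat \<Rightarrow> 'a::field coords \<Rightarrow> 'a coords set" where
  "torus_orbit m p = {q. \<exists>l\<in>torus m. proj_eq (torus_act l p) q}"

definition concat_sign :: "nat set \<Rightarrow> nat set \<Rightarrow> int" where
  "concat_sign A B =
     (let xs = sorted_list_of_set A @ sorted_list_of_set B
      in sign (\<lambda>i. if i \<in> {1..length xs} then xs ! (i - 1) else i))"

text \<open>The rule \<open>p\<^sup>*(I\<^sup>c) = sign(I, I\<^sup>c) p(I)\<close>, written with \<open>J = I\<^sup>c\<close>.\<close>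

definition hodge_star :: "nat \<Rightarrow> 'a::field coords \<Rightarrow> 'a coords" where
  "hodge_star m p J =
     (if J \<subseteq> {1..m} then of_int (concat_sign ({1..m} - J) J) * p ({1..m} - J) else 0)"

definition self_dual :: "nat \<Rightarrow> 'a::field coords \<Rightarrow> bool" where
  "self_dual m p \<longleftrightarrow> (\<exists>l\<in>torus m. proj_eq (hodge_star m p) (torus_act l p))"

definition SGr :: "nat \<Rightarrow> nat \<Rightarrow> 'a::field coords set" where
  "SGr n m = {p \<in> Gr n m. self_dual m p}"

definition config_space :: "nat \<Rightarrow> nat \<Rightarrow> 'a::field coords set set" where
  "config_space n m = torus_orbit m ` {p \<in> Gr n m. all_nonzero n m p}"

definition sd_config_space :: "nat \<Rightarrow> 'a::field coords set set" where
  "sd_config_space n = torus_orbit (2 * n) ` {p \<in> SGr n (2 * n). all_nonzero n (2 * n) p}"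

subsection \<open>General points\<close>

inductive homog_poly :: "nat \<Rightarrow> ('a::field coords \<Rightarrow> 'a) \<Rightarrow> bool" where
  const: "homog_poly 0 (\<lambda>p. c)"
| coord: "homog_poly 1 (\<lambda>p. p I)"
| add: "homog_poly d F \<Longrightarrow> homog_poly d G \<Longrightarrow> homog_poly d (\<lambda>p. F p + G p)"
| mult: "homog_poly d F \<Longrightarrow> homog_poly e G \<Longrightarrow> homog_poly (d + e) (\<lambda>p. F p * G p)"

definition zariski_open_in :: "'a::field coords set \<Rightarrow> 'a coords set \<Rightarrow> bool" where
  "zariski_open_in X U \<longleftrightarrow>
     (\<exists>\<F>. (\<forall>F\<in>\<F>. \<exists>d. homog_poly d F) \<and> U = {p \<in> X. \<exists>F\<in>\<F>. F p \<noteq> 0})"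

definition zariski_dense_in :: "'a::field coords set \<Rightarrow> 'a coords set \<Rightarrow> bool" where
  "zariski_dense_in X U \<longleftrightarrow> (\<forall>V. zariski_open_in X V \<and> V \<noteq> {} \<longrightarrow> U \<inter> V \<noteq> {})"

definition for_general :: "'a::field coords set \<Rightarrow> ('a coords \<Rightarrow> bool) \<Rightarrow> bool" where
  "for_general X P \<longleftrightarrow>
     (\<exists>U. zariski_open_in X U \<and> zariski_dense_in X U \<and> (\<forall>p\<in>U. P p))"

subsection \<open>Cayley octads\<close>

definition quad_form :: "(nat \<Rightarrow> nat \<Rightarrow> 'a::field) \<Rightarrow> 'a vec \<Rightarrow> 'a" where
  "quad_form c x = (\<Sum>i<4. \<Sum>j\<in>{i..<4}. c i j * x $ i * x $ j)"

text \<open>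
  The columns are eight distinct points of projective 3-space, and they are exactly the common zeros of
  three linearly independent quadrics. (Over an algebraically closed field, independence is
  implied by finiteness of the intersection.)
\<close>

definition cayley_octad :: "'a::field mat \<Rightarrow> bool" where
  "cayley_octad A \<longleftrightarrow> A \<in> carrier_mat 4 8 \<and>
     (\<forall>j<8. col A j \<noteq> 0\<^sub>v 4) \<and>
     (\<forall>j<8. \<forall>k<8. j \<noteq> k \<longrightarrow> (\<nexists>s. col A k = s \<cdot>\<^sub>v col A j)) \<and>
     (\<exists>a b c.
        (\<forall>r s t. (\<forall>i<4. \<forall>j\<in>{i..<4}. r * a i j + s * b i j + t * c i j = 0)
                  \<longrightarrow> r = 0 \<and> s = 0 \<and> t = 0) \<and>
        (\<forall>x\<in>carrier_vec 4. x \<noteq> 0\<^sub>v 4 \<longrightarrow>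
           (quad_form a x = 0 \<and> quad_form b x = 0 \<and> quad_form c x = 0 \<longleftrightarrow>
            (\<exists>j<8. \<exists>s. x = s \<cdot>\<^sub>v col A j))))"

text \<open>
  \<open>octad_containing C D\<close>: \<open>D\<close> is the class of a Cayley octad whose first seven points form
  a configuration in the class \<open>C\<close>.
\<close>

definition octad_containing :: "'a::field coords set \<Rightarrow> 'a coords set \<Rightarrow> bool" where
  "octad_containing C D \<longleftrightarrow>
     (\<exists>A. cayley_octad A \<and> D = torus_orbit 8 (plucker 4 8 A) \<and>
          plucker 4 7 (mat 4 7 (\<lambda>(i, j). A $$ (i, j))) \<in> C)"

definition cayley_octad_map :: "'a::field coords set \<Rightarrow> 'a coords set" where
  "cayley_octad_map C = (THE D. octad_containing C D)"

subsection \<open>The explicit formulas\<close>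

definition octad_x :: "'a::field coords \<Rightarrow> nat \<Rightarrow> 'a" where
  "octad_x p i =
    [p {1,2,3,4} * p {1,2,5,6} * p {1,3,5,7} * p {1,4,6,7}
       - p {1,2,3,5} * p {1,2,4,6} * p {1,3,4,7} * p {1,5,6,7},
     p {1,2,3,5} * p {1,2,4,6} * p {2,3,4,7} * p {2,5,6,7}
       - p {1,2,3,4} * p {1,2,5,6} * p {2,3,5,7} * p {2,4,6,7},
     p {1,2,3,4} * p {1,3,5,6} * p {2,3,5,7} * p {3,4,6,7}
       - p {1,2,3,5} * p {1,3,4,6} * p {2,3,4,7} * p {3,5,6,7},
     p {1,2,4,5} * p {1,3,4,6} * p {2,3,4,7} * p {4,5,6,7}
       - p {1,2,3,4} * p {1,4,5,6} * p {2,4,5,7} * p {3,4,6,7},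
     p {1,2,3,5} * p {1,4,5,6} * p {2,4,5,7} * p {3,5,6,7}
       - p {1,2,4,5} * p {1,3,5,6} * p {2,3,5,7} * p {4,5,6,7},
     p {1,2,4,6} * p {1,3,5,6} * p {2,3,6,7} * p {4,5,6,7}
       - p {1,2,3,6} * p {1,4,5,6} * p {2,4,6,7} * p {3,5,6,7},
     p {1,2,3,7} * p {1,4,5,7} * p {2,4,6,7} * p {3,5,6,7}
       - p {1,2,4,7} * p {1,3,5,7} * p {2,3,6,7} * p {4,5,6,7}] ! (i - 1)"

definition octad_vector :: "'a::field coords \<Rightarrow> 'a coords" where
  "octad_vector p J =
     (if J \<subseteq> {1..8} \<and> card J = 4 then
        if 8 \<in> J then
          let I = {1..8} - J in of_int (concat_sign J I) * (p I / (\<Prod>i\<in>I. octad_x p i))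
        else p J
      else 0)"

end

theory Submission
  imports Defs "HOL-Computational_Algebra.Polynomial"
begin

text \<open>
  All seven $x_i$ and all Plucker coordinates are nonzero on a dense open subset of the Grassmannian:
  a line joining two matrices shows that the Grassmannian is irreducible over an infinite field, and
  each factor takes the value $\pm 1$ at some integral point.

  The formulas are equivariant under projective transformations and the torus, so the seven points
  may be taken to be $e_1, \dots, e_4$, $(1,1,1,1)$, $\alpha$, $\beta$. A point $z$ lies on all
  quadrics through them iff $z_i z_j = s + t \alpha_i \alpha_j + u \beta_i \beta_j$ for all $i < j$.
  Comparing the three products $(z_1 z_2)(z_3 z_4)$, $(z_1 z_3)(z_2 z_4)$, $(z_1 z_4)(z_2 z_3)$ gives
  two linear equations for $(st, su, tu)$ whose solutions are the multiples of $(x_7, x_6, x_5)$.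
  Hence either two of $s, t, u$ vanish and $z$ is one of the seven points, or
  $(s, t, u) \sim (1/x_5, 1/x_6, 1/x_7)$, which determines the eighth point.
  Its Plucker coordinates are those of the formula because of linear relations between the $x_i$:
  if $C$ is the matrix with columns $(1,1,1,1)$, $\alpha$, $\beta$ and the eighth point, then
  $C^T \mathrm{diag}(x_1, \dots, x_4) C$ is diagonal with entries $-x_5, -x_6, -x_7, *$.
\<close>

subsection \<open>Plucker coordinates as explicit determinants\<close>

text \<open>The \<open>x i\<close> originate in self-association. Inverting $C^T X C = -Y$ gives
  $X^{-1} + C Y^{-1} C^T = 0$: the matrices $w w^T$ of the eight points $w$, weighted by the
  inverses of \<open>x 1\<close>, ..., \<open>x 7\<close> and of minus the entry $*$, sum to zero.
  Off the diagonal this is a linear relation between the product vectors of the points 5 to 8. It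
  puts the eighth point on every quadric through the others and explains the coefficients
  \<open>1 / x 5\<close>, \<open>1 / x 6\<close>, \<open>1 / x 7\<close>. Two obstacles shape the
  proof. The field is only assumed infinite, so the common zeros cannot be counted by Bezout; they
  are found by solving equations, in every characteristic. And substituting the eighth point into 35
  minors would give unwieldy rational identities; the minors are built up by size instead, so that
  each step needs one denominator-free identity linear in the \<open>x i\<close>. Uniqueness has to
  deal with an arbitrary net of quadrics rather than the constructed one; this is where the
  independence of the net enters.\<close>

definition det4 :: "(nat \<Rightarrow> 'a::comm_ring_1) \<Rightarrow> (nat \<Rightarrow> 'a) \<Rightarrow> (nat \<Rightarrow> 'a) \<Rightarrow> (nat \<Rightarrow> 'a) \<Rightarrow> 'a" where
  "det4 x y z w =
     (x 0 * y 1 - x 1 * y 0) * (z 2 * w 3 - z 3 * w 2)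
   - (x 0 * y 2 - x 2 * y 0) * (z 1 * w 3 - z 3 * w 1)
   + (x 0 * y 3 - x 3 * y 0) * (z 1 * w 2 - z 2 * w 1)
   + (x 1 * y 2 - x 2 * y 1) * (z 0 * w 3 - z 3 * w 0)
   - (x 1 * y 3 - x 3 * y 1) * (z 0 * w 2 - z 2 * w 0)
   + (x 2 * y 3 - x 3 * y 2) * (z 0 * w 1 - z 1 * w 0)"

lemma det_mat_Suc:
  fixes f :: "nat \<times> nat \<Rightarrow> 'a::comm_ring_1"
  shows "det (mat (Suc n) (Suc n) f) =
    (\<Sum>i<Suc n. f (i, 0) * ((-1) ^ i * det (mat n n (\<lambda>(r, s). f (if r < i then r else Suc r, Suc s)))))"
proof -
  have "det (mat (Suc n) (Suc n) f) =
    (\<Sum>i<Suc n. mat (Suc n) (Suc n) f $$ (i, 0) * cofactor (mat (Suc n) (Suc n) f) i 0)"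
    by (rule laplace_expansion_column) auto
  also have "\<dots> = (\<Sum>i<Suc n. f (i, 0) *
      ((-1) ^ i * det (mat n n (\<lambda>(r, s). f (if r < i then r else Suc r, Suc s)))))"
  proof (rule sum.cong[OF refl])
    fix i assume i: "i \<in> {..<Suc n}"
    have "mat_delete (mat (Suc n) (Suc n) f) i 0 =
        mat n n (\<lambda>(r, s). f (if r < i then r else Suc r, Suc s))"
      using i by (intro eq_matI) (auto simp: mat_delete_def)
    then show "mat (Suc n) (Suc n) f $$ (i, 0) * cofactor (mat (Suc n) (Suc n) f) i 0 =
      f (i, 0) * ((-1) ^ i * det (mat n n (\<lambda>(r, s). f (if r < i then r else Suc r, Suc s))))"
      using i by (simp add: cofactor_def)
  qed
  finally show ?thesis .
qed

text \<open>\<open>det4\<close> is the Laplace expansion along the first two columns, pairing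
  complementary 2 by 2 minors. Four expansions along a first column give the same 24
  monomials.\<close>

lemma det_mat4:
  fixes f :: "nat \<times> nat \<Rightarrow> 'a::comm_ring_1"
  shows "det (mat 4 4 f) =
    det4 (\<lambda>i. f (i, 0)) (\<lambda>i. f (i, 1)) (\<lambda>i. f (i, 2)) (\<lambda>i. f (i, 3))"
proof -
  have "det (mat (Suc (Suc (Suc (Suc 0)))) (Suc (Suc (Suc (Suc 0)))) f) =
    det4 (\<lambda>i. f (i, 0)) (\<lambda>i. f (i, Suc 0)) (\<lambda>i. f (i, Suc (Suc 0))) (\<lambda>i. f (i, Suc (Suc (Suc 0))))"
    by (simp add: det_mat_Suc det4_def numeral_2_eq_2 numeral_3_eq_3 algebra_simps)
  then show ?thesis
    by (simp add: numeral_2_eq_2 numeral_3_eq_3 eval_nat_numeral)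
qed

lemma sorted_list_of_set_four:
  fixes i j k l :: nat
  assumes "i < j" "j < k" "k < l"
  shows "sorted_list_of_set {i, j, k, l} = [i, j, k, l]"
  using assms by (intro sorted_distinct_set_unique) auto

lemma card_four:
  fixes i j k l :: nat
  assumes "i < j" "j < k" "k < l"
  shows "card {i, j, k, l} = 4"
  using assms by (simp add: card_insert_if)

lemma plucker_four:
  assumes "0 < i" "i < j" "j < k" "k < l" "l \<le> m"
  shows "plucker 4 m A {i, j, k, l} =
    det4 (\<lambda>r. A $$ (r, i - 1)) (\<lambda>r. A $$ (r, j - 1)) (\<lambda>r. A $$ (r, k - 1)) (\<lambda>r. A $$ (r, l - 1))"
proof -
  have "{i, j, k, l} \<subseteq> {1..m}" using assms by auto
  then show ?thesis
    using assms
    by (simp add: plucker_def card_four sorted_list_of_set_four det_mat4 numeral_2_eq_2 numeral_3_eq_3)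
qed

definition cols_mat :: "nat \<Rightarrow> 'a list list \<Rightarrow> 'a mat" where
  "cols_mat m W = mat 4 m (\<lambda>(r, s). W ! s ! r)"

lemma cols_mat_carrier: "cols_mat m W \<in> carrier_mat 4 m"
  by (simp add: cols_mat_def)

lemma plucker_cols_mat:
  assumes "0 < i" "i < j" "j < k" "k < l" "l \<le> m"
  shows "plucker 4 m (cols_mat m W) {i, j, k, l} =
    det4 ((!) (W ! (i - 1))) ((!) (W ! (j - 1))) ((!) (W ! (k - 1))) ((!) (W ! (l - 1)))"
  using assms by (simp add: plucker_four cols_mat_def det4_def)

lemma det4_lists:
  "det4 ((!) [x0, x1, x2, x3]) ((!) [y0, y1, y2, y3]) ((!) [z0, z1, z2, z3]) ((!) [w0, w1, w2, w3]) =
     (x0 * y1 - x1 * y0) * (z2 * w3 - z3 * w2)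
   - (x0 * y2 - x2 * y0) * (z1 * w3 - z3 * w1)
   + (x0 * y3 - x3 * y0) * (z1 * w2 - z2 * w1)
   + (x1 * y2 - x2 * y1) * (z0 * w3 - z3 * w0)
   - (x1 * y3 - x3 * y1) * (z0 * w2 - z2 * w0)
   + (x2 * y3 - x3 * y2) * (z0 * w1 - z1 * w0)"
  by (simp add: det4_def)

lemma four_subsetE:
  fixes I :: "nat set"
  assumes "I \<subseteq> {1..m}" "card I = 4"
  obtains i j k l where "0 < i" "i < j" "j < k" "k < l" "l \<le> m" "I = {i, j, k, l}"
proof -
  have fin: "finite I" using assms(1) finite_subset by blast
  define xs where "xs = sorted_list_of_set I"
  have len: "length xs = 4" and set: "set xs = I" and "sorted_wrt (<) xs"
    using assms(2) fin by (simp_all add: xs_def)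
  then obtain i j k l where xs: "xs = [i, j, k, l]"
    by (auto simp: eval_nat_numeral length_Suc_conv)
  have "i < j" "j < k" "k < l" using \<open>sorted_wrt (<) xs\<close> xs by auto
  moreover have I: "I = {i, j, k, l}" using set xs by auto
  moreover have "0 < i" "l \<le> m" using assms(1) I by auto
  ultimately show ?thesis using that by blast
qed

subsection \<open>The sign of a permutation by counting inversions\<close>

text \<open>The sign used in \<open>concat_sign\<close>, but for a single list, so that adjacent
  entries can be swapped across the boundary between the two blocks.\<close>

definition list_sign :: "nat list \<Rightarrow> int" where
  "list_sign xs = sign (\<lambda>i. if i \<in> {1..length xs} then xs ! (i - 1) else i)"

fun inversions :: "nat list \<Rightarrow> nat" where
  "inversions [] = 0"
| "inversions (x # xs) = length (filter (\<lambda>y. y < x) xs) + inversions xs"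

lemma list_permutes:
  assumes "distinct xs" "set xs = {1..length xs}"
  shows "(\<lambda>i. if i \<in> {1..length xs} then xs ! (i - 1) else i) permutes {1..length xs}"
proof (rule bij_imp_permutes)
  have "bij_betw (\<lambda>i. i - 1) {1..length xs} {..<length xs}"
    by (rule bij_betwI[where g = Suc]) auto
  moreover have "bij_betw ((!) xs) {..<length xs} {1..length xs}"
    using assms by (intro bij_betw_nth) auto
  ultimately have "bij_betw ((!) xs \<circ> (\<lambda>i. i - 1)) {1..length xs} {1..length xs}"
    by (rule bij_betw_trans)
  then show "bij_betw (\<lambda>i. if i \<in> {1..length xs} then xs ! (i - 1) else i) {1..length xs} {1..length xs}"
    by (rule bij_betw_cong[THEN iffD1, rotated]) auto
qed auto

lemma inversions_append_swap:
  assumes "b < a"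
  shows "inversions (ys @ a # b # zs) = Suc (inversions (ys @ b # a # zs))"
  using assms by (induction ys) auto

text \<open>Swapping two neighbouring entries composes the permutation on the left with the
  transposition of the two values \<open>a\<close> and \<open>b\<close>, not of their
  positions.\<close>

lemma list_sign_swap:
  assumes "distinct (ys @ a # b # zs)" "set (ys @ a # b # zs) = {1..length (ys @ a # b # zs)}"
  shows "list_sign (ys @ a # b # zs) = - list_sign (ys @ b # a # zs)"
proof -
  let ?f = "\<lambda>xs i. if i \<in> {1..length xs} then xs ! (i - 1) else (i::nat)"
  let ?xs = "ys @ a # b # zs" and ?xs' = "ys @ b # a # zs"
  have p: "permutation (?f ?xs)" "permutation (?f ?xs')"
    using list_permutes[of ?xs] list_permutes[of ?xs'] assms
    by (auto intro!: permutes_imp_permutation[of "{1..length ?xs}"] simp: insert_commute)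
  have lt: "\<And>i. i < length zs \<Longrightarrow> zs ! i \<noteq> a \<and> zs ! i \<noteq> b" "\<And>i. i < length ys \<Longrightarrow> ys ! i \<noteq> a \<and> ys ! i \<noteq> b"
    "a \<noteq> b"
    using assms(1) by (auto simp: in_set_conv_nth)
  have ab: "a \<in> {1..length ?xs}" "b \<in> {1..length ?xs}"
    using assms(2) by auto
  have "?f ?xs = transpose a b \<circ> ?f ?xs'"
  proof
    fix i
    show "?f ?xs i = (transpose a b \<circ> ?f ?xs') i"
    proof (cases "i \<in> {1..length ?xs}")
      case True
      then obtain n where n: "i = Suc n" "n < length ?xs" by (cases i) auto
      have "?xs ! n = transpose a b (?xs' ! n)"
        using n(2) lt
        by (auto simp: nth_append nth_Cons transpose_def split: nat.splits)
      with True n show ?thesis by simp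
    next
      case False
      with ab have "i \<noteq> a" "i \<noteq> b" by blast+
      with False show ?thesis by (auto simp: transpose_def)
    qed
  qed
  then have "list_sign ?xs = sign (transpose a b) * list_sign ?xs'"
    using p by (simp add: list_sign_def sign_compose permutation_swap_id)
  then show ?thesis using lt by (simp add: sign_swap_id)
qed

text \<open>Bubble sort: swapping a neighbouring descent removes exactly one inversion and flips the
  sign, and the sorted list is the identity.\<close>

lemma list_sign_inversions:
  assumes "distinct xs" "set xs = {1..length xs}"
  shows "list_sign xs = (-1) ^ inversions xs"
  using assms
proof (induction "inversions xs" arbitrary: xs rule: less_induct)
  case less
  show ?case
  proof (cases "sorted xs")
    case True
    have set: "set xs = set [1..<Suc (length xs)]"
      unfolding less.prems(2) by (simp only: set_upt atLeastLessThanSuc_atLeastAtMost)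
    have "xs = [1..<Suc (length xs)]"
      by (rule sorted_distinct_set_unique[OF True less.prems(1) _ _ set]) (simp_all only: sorted_upt distinct_upt)
    from arg_cong[OF this, of "\<lambda>ys. ys ! i" for i]
    have nth: "xs ! i = Suc i" if "i < length xs" for i
      using that by (simp only: nth_upt)
    have "(\<lambda>i. if i \<in> {1..length xs} then xs ! (i - 1) else i) = (\<lambda>i. i)"
      by (rule ext) (auto simp: nth)
    then have "list_sign xs = 1" by (simp only: list_sign_def sign_identity)
    moreover have "inversions xs = 0"
      using True by (induction xs) (auto simp: filter_empty_conv not_less)
    ultimately show ?thesis by simp
  next
    case False
    then obtain i where i: "Suc i < length xs" "xs ! Suc i < xs ! i"
      by (auto simp: sorted_iff_nth_Suc not_le)
    define ys a b zs where "ys = take i xs" and "a = xs ! i" and "b = xs ! Suc i"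
      and "zs = drop (Suc (Suc i)) xs"
    have xs: "xs = ys @ a # b # zs"
      using i by (simp add: ys_def a_def b_def zs_def Cons_nth_drop_Suc)
    have inv: "inversions xs = Suc (inversions (ys @ b # a # zs))"
      unfolding xs by (rule inversions_append_swap) (use i in \<open>simp add: a_def b_def\<close>)
    have "list_sign (ys @ b # a # zs) = (-1) ^ inversions (ys @ b # a # zs)"
      using less.prems by (intro less.hyps) (auto simp: xs inv[unfolded xs] insert_commute)
    then show ?thesis
      using list_sign_swap[of ys a b zs] less.prems inv by (simp add: xs)
  qed
qed

text \<open>Makes the signs of concrete index sets computable by simplification.\<close>

lemma concat_sign_inversions:
  assumes "finite A" "finite B" "A \<inter> B = {}" "A \<union> B = {1..card A + card B}"
  shows "concat_sign A B = (-1) ^ inversions (sorted_list_of_set A @ sorted_list_of_set B)"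
proof -
  have "concat_sign A B = list_sign (sorted_list_of_set A @ sorted_list_of_set B)"
    by (simp add: concat_sign_def list_sign_def Let_def)
  also have "\<dots> = (-1) ^ inversions (sorted_list_of_set A @ sorted_list_of_set B)"
    using assms by (intro list_sign_inversions) auto
  finally show ?thesis .
qed

subsection \<open>Torus orbits\<close>

text \<open>The projective factor and the torus element are kept together, so that moves inside an
  orbit compose and invert as one operation.\<close>

definition scaled :: "'a::field \<Rightarrow> (nat \<Rightarrow> 'a) \<Rightarrow> 'a coords \<Rightarrow> 'a coords" where
  "scaled c l p = (\<lambda>I. c * torus_act l p I)"

lemma scaled_apply: "scaled c l p I = c * ((\<Prod>i\<in>I. l i) * p I)"
  by (simp add: scaled_def torus_act_def)

lemma torus_orbit_iff:
  "q \<in> torus_orbit m p \<longleftrightarrow> (\<exists>c l. c \<noteq> 0 \<and> l \<in> torus m \<and> q = scaled c l p)"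
  by (auto simp: torus_orbit_def proj_eq_def scaled_def)

lemma scaled_scaled:
  "scaled c l (scaled d k p) = scaled (c * d) (\<lambda>i. l i * k i) p"
  by (rule ext) (simp add: scaled_apply prod.distrib mult_ac)

text \<open>A torus element is constrained only on \<open>{1..m}\<close> and may vanish elsewhere;
  hence the condition on the support of \<open>p\<close>.\<close>

lemma scaled_inverse:
  assumes "c \<noteq> 0" "l \<in> torus m" "\<And>I. \<not> I \<subseteq> {1..m} \<Longrightarrow> p I = 0"
  shows "scaled (inverse c) (\<lambda>i. inverse (l i)) (scaled c l p) = p"
proof
  fix I
  show "scaled (inverse c) (\<lambda>i. inverse (l i)) (scaled c l p) I = p I"
  proof (cases "I \<subseteq> {1..m}")
    case True
    then have "inverse (l i) * l i = 1" if "i \<in> I" for i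
      using that assms(2) by (auto simp: torus_def)
    then have "(\<Prod>i\<in>I. inverse (l i) * l i) = 1" by simp
    then show ?thesis using assms(1) unfolding scaled_scaled scaled_apply by simp
  qed (simp add: scaled_apply assms(3))
qed

lemma torus_mult: "l \<in> torus m \<Longrightarrow> k \<in> torus m \<Longrightarrow> (\<lambda>i. l i * k i) \<in> torus m"
  by (simp add: torus_def)

lemma torus_inverse: "l \<in> torus m \<Longrightarrow> (\<lambda>i. inverse (l i)) \<in> torus m"
  by (simp add: torus_def)

lemma torus_orbit_scaled:
  assumes "c \<noteq> 0" "l \<in> torus m" "\<And>I. \<not> I \<subseteq> {1..m} \<Longrightarrow> p I = 0"
  shows "torus_orbit m (scaled c l p) = torus_orbit m p"
proof (intro equalityI subsetI)
  fix q assume "q \<in> torus_orbit m (scaled c l p)"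
  then obtain d k where "d \<noteq> 0" "k \<in> torus m" "q = scaled d k (scaled c l p)"
    by (auto simp: torus_orbit_iff)
  with assms show "q \<in> torus_orbit m p"
    unfolding torus_orbit_iff scaled_scaled using torus_mult[of k m l]
    by (metis mult_eq_0_iff)
next
  fix q assume "q \<in> torus_orbit m p"
  then obtain d k where q: "d \<noteq> 0" "k \<in> torus m" "q = scaled d k p"
    by (auto simp: torus_orbit_iff)
  have "scaled (d * inverse c) (\<lambda>i. k i * inverse (l i)) (scaled c l p)
      = scaled d k (scaled (inverse c) (\<lambda>i. inverse (l i)) (scaled c l p))"
    by (rule scaled_scaled[symmetric])
  moreover have "scaled (inverse c) (\<lambda>i. inverse (l i)) (scaled c l p) = p"
    by (rule scaled_inverse) (use assms in auto)
  ultimately have "q = scaled (d * inverse c) (\<lambda>i. k i * inverse (l i)) (scaled c l p)"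
    using q by simp
  moreover have "d * inverse c \<noteq> 0" using q assms by simp
  moreover have "(\<lambda>i. k i * inverse (l i)) \<in> torus m"
    using q assms torus_mult torus_inverse by blast
  ultimately show "q \<in> torus_orbit m (scaled c l p)"
    unfolding torus_orbit_iff by blast
qed

lemma torus_orbit_self: "p \<in> torus_orbit m p"
proof -
  have "p = scaled 1 (\<lambda>i. 1) p" by (simp add: scaled_def torus_act_def)
  moreover have "(\<lambda>i. 1) \<in> torus m" by (simp add: torus_def)
  ultimately show ?thesis unfolding torus_orbit_iff by (metis zero_neq_one)
qed

lemma scaled_eq_0_iff:
  assumes "c \<noteq> 0" "l \<in> torus m" "I \<subseteq> {1..m}"
  shows "scaled c l p I = 0 \<longleftrightarrow> p I = 0"
  using assms finite_subset[OF assms(3)]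
  by (auto simp: scaled_apply torus_def)

section \<open>Equivariance of the Plucker coordinates and of the formulas\<close>

lemma plucker_eq_0: "\<not> I \<subseteq> {1..m} \<Longrightarrow> plucker n m A I = 0"
  by (simp add: plucker_def)

lemma Gr_eq_0: "p \<in> Gr n m \<Longrightarrow> \<not> I \<subseteq> {1..m} \<Longrightarrow> p I = 0"
  unfolding Gr_def using plucker_eq_0 by blast

lemma octad_vector_eq_0: "\<not> I \<subseteq> {1..8} \<Longrightarrow> octad_vector p I = 0"
  by (simp add: octad_vector_def)

text \<open>The submatrix of \<open>B\<close> on the columns \<open>I\<close> factors as
  \<open>h\<close> times that of \<open>N\<close> times a diagonal matrix, and the determinant is
  multiplicative.\<close>

lemma plucker_transform:
  assumes h: "h \<in> carrier_mat n n" and N: "N \<in> carrier_mat n m" and B: "B \<in> carrier_mat n m"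
    and eq: "\<And>i j. i < n \<Longrightarrow> j < m \<Longrightarrow> B $$ (i, j) = l (Suc j) * (h * N) $$ (i, j)"
  shows "plucker n m B = scaled (det h) l (plucker n m N)"
proof
  fix I
  show "plucker n m B I = scaled (det h) l (plucker n m N) I"
  proof (cases "I \<subseteq> {1..m} \<and> card I = n")
    case True
    define xs where "xs = sorted_list_of_set I"
    have fin: "finite I" using True finite_subset by blast
    have xs: "length xs = n" "set xs = I" "distinct xs"
      using True fin by (simp_all add: xs_def)
    have nth: "xs ! j - 1 < m" "Suc (xs ! j - 1) = xs ! j" if "j < n" for j
    proof -
      have "xs ! j \<in> {1..m}" using that xs True nth_mem by blast
      then show "xs ! j - 1 < m" "Suc (xs ! j - 1) = xs ! j" by auto
    qed
    let ?N = "mat n n (\<lambda>(i, j). N $$ (i, xs ! j - 1))"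
    let ?D = "mat_diag n (\<lambda>j. l (xs ! j))"
    have "mat n n (\<lambda>(i, j). B $$ (i, xs ! j - 1)) = h * ?N * ?D"
    proof (rule eq_matI)
      fix i j assume "i < dim_row (h * ?N * ?D)" "j < dim_col (h * ?N * ?D)"
      then have ij: "i < n" "j < n" using h by (auto simp: mat_diag_def)
      have col: "col ?N j = col N (xs ! j - 1)"
        using ij nth N by (intro eq_vecI) auto
      have "B $$ (i, xs ! j - 1) = l (xs ! j) * (row h i \<bullet> col N (xs ! j - 1))"
        using eq[of i "xs ! j - 1"] ij nth h N by simp
      moreover have "(h * ?N * ?D) $$ (i, j) = (h * ?N) $$ (i, j) * l (xs ! j)"
        using h ij by (subst mat_diag_mult_right[of _ n n]) auto
      ultimately show "mat n n (\<lambda>(i, j). B $$ (i, xs ! j - 1)) $$ (i, j) = (h * ?N * ?D) $$ (i, j)"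
        using ij h col by simp
    qed (use h in \<open>auto simp: mat_diag_def\<close>)
    then have "det (mat n n (\<lambda>(i, j). B $$ (i, xs ! j - 1))) = det h * det ?N * det ?D"
      using h by (simp add: det_mult[of _ n] mat_diag_dim)
    moreover have "det ?D = (\<Prod>i\<in>I. l i)"
    proof -
      have "det ?D = prod_list (diag_mat ?D)"
        by (rule det_upper_triangular[of _ n]) (auto simp: mat_diag_def)
      also have "diag_mat ?D = map l xs"
        using xs(1) by (auto simp: diag_mat_def mat_diag_def intro!: nth_equalityI)
      finally show ?thesis using xs by (metis prod.distinct_set_conv_list)
    qed
    ultimately show ?thesis
      using True by (simp add: plucker_def scaled_apply xs_def mult_ac)
  qed (auto simp: plucker_def scaled_apply)
qed

lemma Gr_scaled:
  assumes p: "p \<in> Gr n m" and "0 < n" "c \<noteq> 0" "l \<in> torus m"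
  shows "scaled c l p \<in> Gr n m"
proof -
  obtain A where A: "A \<in> carrier_mat n m" "p = plucker n m A" and nz: "\<exists>I. p I \<noteq> 0"
    using p by (auto simp: Gr_def)
  \<comment> \<open>The projective factor \<open>c\<close> is absorbed into the first row, which
    exists because \<open>0 < n\<close>.\<close>
  define h where "h = mat_diag n (\<lambda>i. if i = 0 then c else 1)"
  define B where "B = mat n m (\<lambda>(i, j). l (Suc j) * (h * A) $$ (i, j))"
  have h: "h \<in> carrier_mat n n" by (simp add: h_def mat_diag_dim)
  have "det h = prod_list (diag_mat h)"
    by (rule det_upper_triangular[of _ n]) (auto simp: h_def mat_diag_def)
  also have "\<dots> = (\<Prod>i<n. if i = 0 then c else 1)"
    by (simp add: diag_mat_def h_def mat_diag_def prod.list_conv_set_nth atLeast0LessThan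
        prod.distinct_set_conv_list[symmetric])
  also have "\<dots> = c"
    using \<open>0 < n\<close> by (simp add: prod.delta)
  finally have "det h = c" .
  then have eq: "plucker n m B = scaled c l p"
    using plucker_transform[OF h A(1), of B l] A(2) by (simp add: B_def)
  moreover have "B \<in> carrier_mat n m" by (simp add: B_def)
  moreover from nz obtain I where "p I \<noteq> 0" by blast
  then have "plucker n m B I \<noteq> 0"
    using Gr_eq_0[OF p, of I] scaled_eq_0_iff[OF \<open>c \<noteq> 0\<close> \<open>l \<in> torus m\<close>, of I p] eq by auto
  ultimately show ?thesis unfolding Gr_def by force
qed

text \<open>In both monomials of \<open>octad_x p i\<close> the index \<open>i\<close> occurs in all
  four Plucker coordinates and every other index of \<open>{1..7}\<close> in exactly two.\<close>

lemma octad_x_scaled: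
  assumes "i \<in> {1..7}"
  shows "octad_x (scaled c l p) i = c ^ 4 * (l i)\<^sup>2 * (\<Prod>j\<in>{1..7}. l j)\<^sup>2 * octad_x p i"
proof -
  have set7: "{1..7} = {1, 2, 3, 4, 5, 6, 7::nat}" by auto
  have L: "(\<Prod>j\<in>{1..7}. l j) = l 1 * l 2 * l 3 * l 4 * l 5 * l 6 * l 7"
    unfolding set7 by (simp add: mult_ac)
  have c4: "c ^ 4 = c * c * c * c" by (simp add: power_numeral_reduce mult.assoc)
  from assms have "i = 1 \<or> i = 2 \<or> i = 3 \<or> i = 4 \<or> i = 5 \<or> i = 6 \<or> i = 7"
    unfolding set7 by simp
  then show ?thesis
    unfolding L power2_eq_square c4
    by (elim disjE; simp only:)
      (simp_all add: octad_x_def scaled_apply algebra_simps)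
qed

lemma subset_seven:
  assumes "I \<subseteq> {1..8}" "8 \<notin> I"
  shows "I \<subseteq> {1..7::nat}"
proof
  fix i assume "i \<in> I"
  then have "i \<in> {1..8}" "i \<noteq> 8" using assms by auto
  then show "i \<in> {1..7}" by auto
qed

lemma prod_complement_seven:
  fixes l :: "nat \<Rightarrow> 'a::comm_monoid_mult"
  assumes "J \<subseteq> {1..8}" "8 \<in> J"
  shows "(\<Prod>i\<in>{1..8} - J. l i) * (\<Prod>i\<in>J - {8}. l i) = (\<Prod>i\<in>{1..7}. l i)"
proof -
  have "{1..8} - {8} = {1..7::nat}" by auto
  then have "{1..7} = ({1..8} - J) \<union> (J - {8})" using assms by blast
  then show ?thesis
    by (metis (no_types, lifting) Diff_disjoint Diff_subset_conv Int_Diff assms(1) finite_Diff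
        finite_atLeastAtMost finite_subset inf_commute prod.union_disjoint Int_empty_left)
qed

text \<open>The weight at 8 is forced. Write \<open>L\<close> for the product of all seven weights
  and \<open>k\<close> for that over \<open>I\<close>. By \<open>octad_x_scaled\<close> the quotient
  in the formula is multiplied by \<open>c * k / (c ^ 16 * k\<^sup>2 * L ^ 8)\<close>, while
  \<open>J\<close> carries the weight \<open>L / k\<close> times that of 8.\<close>

lemma octad_vector_scaled:
  fixes p :: "'a::field coords"
  assumes "c \<noteq> 0" "l \<in> torus 7"
  defines "l' \<equiv> l(8 := inverse (c ^ 16 * (\<Prod>j\<in>{1..7}. l j) ^ 9))"
  shows "octad_vector (scaled c l p) = scaled c l' (octad_vector p)" and "l' \<in> torus 8"
proof -
  have eight: "{1..8} - {8} = {1..7::nat}" by auto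
  define L where "L = (\<Prod>j\<in>{1..7}. l j)"
  have L: "L \<noteq> 0" using assms(2) by (auto simp: L_def torus_def)
  show "l' \<in> torus 8"
    using assms(1,2) L eight unfolding l'_def L_def torus_def by auto
  show "octad_vector (scaled c l p) = scaled c l' (octad_vector p)"
  proof
    fix J :: "nat set"
    consider "\<not> (J \<subseteq> {1..8} \<and> card J = 4)" | "J \<subseteq> {1..8}" "card J = 4" "8 \<notin> J"
      | "J \<subseteq> {1..8}" "card J = 4" "8 \<in> J" by blast
    then show "octad_vector (scaled c l p) J = scaled c l' (octad_vector p) J"
    proof cases
      case 1
      then show ?thesis by (auto simp: octad_vector_def scaled_apply)
    next
      case 2
      then have "(\<Prod>i\<in>J. l' i) = (\<Prod>i\<in>J. l i)"
        by (intro prod.cong) (auto simp: l'_def)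
      with 2 show ?thesis by (simp add: octad_vector_def scaled_apply)
    next
      case 3
      define I where "I = {1..8} - J"
      have fin: "finite J" using 3(1) finite_subset by blast
      have I: "I \<subseteq> {1..7}" using 3 eight by (auto simp: I_def)
      have card: "card I = 4" using 3 fin by (simp add: I_def card_Diff_subset)
      define k where "k = (\<Prod>i\<in>I. l i)"
      have k: "k \<noteq> 0" using assms(2) I finite_subset[OF I] by (auto simp: k_def torus_def)
      have "(\<Prod>i\<in>I. octad_x (scaled c l p) i) = (\<Prod>i\<in>I. c ^ 4 * (l i)\<^sup>2 * L\<^sup>2 * octad_x p i)"
        using I by (intro prod.cong refl) (auto simp: octad_x_scaled L_def)
      also have "\<dots> = c ^ 16 * k\<^sup>2 * L ^ 8 * (\<Prod>i\<in>I. octad_x p i)"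
        by (simp add: prod.distrib card k_def prod_power_distrib power_mult[symmetric])
      finally have x: "(\<Prod>i\<in>I. octad_x (scaled c l p) i) = c ^ 16 * k\<^sup>2 * L ^ 8 * (\<Prod>i\<in>I. octad_x p i)" .
      have "k * (\<Prod>i\<in>J - {8}. l i) = L"
        unfolding k_def I_def L_def using 3 by (intro prod_complement_seven)
      moreover have "(\<Prod>i\<in>J - {8}. l' i) = (\<Prod>i\<in>J - {8}. l i)"
        by (intro prod.cong) (auto simp: l'_def)
      ultimately have "k * (\<Prod>i\<in>J. l' i) = l' 8 * L"
        using 3(3) fin by (simp add: prod.remove[of J 8] mult_ac)
      then have "(\<Prod>i\<in>J. l' i) = l' 8 * L / k" using k by (simp add: field_simps)
      also have "l' 8 = inverse (c ^ 16 * L ^ 9)"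
        by (simp only: l'_def L_def fun_upd_same)
      also have "inverse (c ^ 16 * L ^ 9) * L / k = 1 / (c ^ 16 * L ^ 8 * k)"
        using k L assms(1) by (simp add: field_simps power_numeral_reduce)
      finally have l': "(\<Prod>i\<in>J. l' i) = 1 / (c ^ 16 * L ^ 8 * k)" .
      have eq: "scaled c l p I / (\<Prod>i\<in>I. octad_x (scaled c l p) i)
          = c * ((\<Prod>i\<in>J. l' i) * (p I / (\<Prod>i\<in>I. octad_x p i)))"
        unfolding x l' using k L assms(1)
        by (simp add: scaled_apply k_def[symmetric] power2_eq_square)
      have "octad_vector q J = of_int (concat_sign J I) * (q I / (\<Prod>i\<in>I. octad_x q i))"
        for q :: "'a coords"
        using 3 by (simp add: octad_vector_def I_def Let_def)
      then show ?thesis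
        by (simp only: scaled_apply[of c l'] eq mult_ac)
    qed
  qed
qed

subsection \<open>Self-duality\<close>

text \<open>Exchanging two blocks of length four is a product of four transpositions, hence
  even.\<close>

lemma concat_sign_complement_commute:
  assumes "I \<subseteq> {1..8}" "card I = 4"
  shows "concat_sign I ({1..8} - I) = concat_sign ({1..8} - I) I"
proof -
  define J where "J = {1..8} - I"
  have fin: "finite I" "finite J" using assms finite_subset by (auto simp: J_def)
  have card: "card J = 4" using assms fin by (simp add: J_def card_Diff_subset)
  have U: "I \<union> J = {1..8}" "I \<inter> J = {}" using assms by (auto simp: J_def)
  define f where "f = (\<lambda>i::nat. if i \<in> {1..4} then i + 4 else if i \<in> {5..8} then i - 4 else i)"
  let ?g = "\<lambda>A B i. if i \<in> {1..8::nat} then (sorted_list_of_set A @ sorted_list_of_set B) ! (i - 1) else i"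
  have perm: "permutation (?g J I)"
    using list_permutes[of "sorted_list_of_set J @ sorted_list_of_set I"] fin card assms U
    by (auto intro!: permutes_imp_permutation[of "{1..8}"] simp: Un_commute Int_commute)
  have f: "f = transpose 1 5 \<circ> (transpose 2 6 \<circ> (transpose 3 7 \<circ> transpose 4 8))"
  proof
    fix i :: nat
    have "i \<in> {1,2,3,4,5,6,7,8} \<or> i \<notin> {1..8}" by auto
    then show "f i = (transpose 1 5 \<circ> (transpose 2 6 \<circ> (transpose 3 7 \<circ> transpose 4 8))) i"
      by (auto simp: f_def transpose_def)
  qed
  have "sign f = 1" "permutation f"
    unfolding f by (simp_all add: sign_compose permutation_compose permutation_swap_id sign_swap_id)
  moreover have "?g I J = ?g J I \<circ> f"
    using assms card by (auto simp: fun_eq_iff f_def nth_append)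
  ultimately have "sign (?g I J) = sign (?g J I)"
    using perm by (simp add: sign_compose)
  then show ?thesis
    unfolding J_def[symmetric] by (simp add: concat_sign_def assms(2) card)
qed

lemma concat_sign_square: "concat_sign A B * concat_sign A B = 1"
  by (simp add: concat_sign_def Let_def)

text \<open>The torus element has weights \<open>1 / octad_x p i\<close> for
  \<open>i \<le> 7\<close> and their inverse product at 8. A set without 8 then has the weight in
  the formula, and a set containing 8 has the product of \<open>octad_x p\<close> over its
  complement. The two resulting equations agree because the sign is symmetric in a four-set and its
  complement.\<close>

lemma octad_vector_self_dual:
  fixes p :: "'a::field coords"
  assumes x: "\<And>i. i \<in> {1..7} \<Longrightarrow> octad_x p i \<noteq> 0"
  shows "self_dual 8 (octad_vector p)"
proof -
  define X where "X = (\<Prod>i\<in>{1..7}. octad_x p i)"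
  define l where "l = (\<lambda>i. inverse (octad_x p i))(8 := X)"
  have "X \<noteq> 0" using x by (simp add: X_def)
  then have "l \<in> torus 8" using x subset_seven[of "{1..8} - {8}"] by (auto simp: l_def torus_def)
  have sq: "of_int (concat_sign A B) * (of_int (concat_sign A B) * z) = z" for A B and z :: 'a
    by (simp only: mult.assoc[symmetric] of_int_mult[symmetric] concat_sign_square) simp
  have "torus_act l (octad_vector p) J = hodge_star 8 (octad_vector p) J" for J
  proof -
    consider "\<not> (J \<subseteq> {1..8} \<and> card J = 4)" | "J \<subseteq> {1..8}" "card J = 4" "8 \<notin> J"
      | "J \<subseteq> {1..8}" "card J = 4" "8 \<in> J" by blast
    then show ?thesis
    proof cases
      case 1
      then have "card ({1..8} - J) \<noteq> 4" if "J \<subseteq> {1..8}"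
        using that finite_subset[OF that] card_mono[OF _ that] by (auto simp: card_Diff_subset)
      with 1 show ?thesis
        by (auto simp: torus_act_def hodge_star_def octad_vector_def)
    next
      case 2
      have "finite J" using 2(1) finite_subset by blast
      then have c: "card ({1..8} - J) = 4" using 2 by (simp add: card_Diff_subset)
      have "(\<Prod>i\<in>J. l i) = inverse (\<Prod>i\<in>J. octad_x p i)"
        using 2 unfolding prod_inversef[symmetric] by (intro prod.cong) (auto simp: l_def)
      moreover have "{1..8} - ({1..8} - J) = J" using 2 by auto
      then have "octad_vector p ({1..8} - J) =
          of_int (concat_sign ({1..8} - J) J) * (p J / (\<Prod>i\<in>J. octad_x p i))"
        using 2 c by (simp add: octad_vector_def Let_def)
      moreover have "octad_vector p J = p J" using 2 by (simp add: octad_vector_def)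
      ultimately show ?thesis
        unfolding torus_act_def hodge_star_def using 2(1)
        by (simp only: if_True sq) (simp add: divide_inverse mult.commute)
    next
      case 3
      define I where "I = {1..8} - J"
      have fin: "finite J" using 3(1) finite_subset by blast
      have card: "card I = 4" using 3 fin by (simp add: I_def card_Diff_subset)
      have I: "I \<subseteq> {1..8}" "8 \<notin> I" "{1..8} - I = J" using 3 by (auto simp: I_def)
      have sgn: "concat_sign I J = concat_sign J I"
        using concat_sign_complement_commute[of J] 3 by (simp add: I_def)
      have "I \<subseteq> {1..7}" using I by (intro subset_seven)
      then have nz: "(\<Prod>i\<in>I. octad_x p i) \<noteq> 0"
        using x finite_subset[of I "{1..7}"] by auto
      have nz': "(\<Prod>i\<in>J - {8}. octad_x p i) \<noteq> 0"
        using x subset_seven[of "J - {8}"] 3 fin by auto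
      have "(\<Prod>i\<in>I. octad_x p i) * (\<Prod>i\<in>J - {8}. octad_x p i) = X"
        unfolding X_def I_def using 3 by (intro prod_complement_seven)
      moreover have "(\<Prod>i\<in>J. l i) = X * (\<Prod>i\<in>J - {8}. l i)"
        using 3 fin by (simp add: prod.remove[of J 8] l_def)
      moreover have "(\<Prod>i\<in>J - {8}. l i) = inverse (\<Prod>i\<in>J - {8}. octad_x p i)"
        unfolding prod_inversef[symmetric] by (intro prod.cong) (auto simp: l_def)
      ultimately have "(\<Prod>i\<in>J. l i) = (\<Prod>i\<in>I. octad_x p i)"
        using nz' by (metis (no_types) mult.assoc right_inverse mult_1_right)
      moreover have "octad_vector p J = of_int (concat_sign J I) * (p I / (\<Prod>i\<in>I. octad_x p i))"
        using 3 by (simp add: octad_vector_def I_def Let_def)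
      moreover have "octad_vector p I = p I"
        using I card by (simp add: octad_vector_def)
      moreover have "hodge_star 8 (octad_vector p) J = of_int (concat_sign I J) * octad_vector p I"
        using 3 by (simp add: hodge_star_def I_def)
      ultimately show ?thesis
        using nz by (simp add: torus_act_def sgn)
    qed
  qed
  then have "torus_act l (octad_vector p) = (\<lambda>J. 1 * hodge_star 8 (octad_vector p) J)" by auto
  with \<open>l \<in> torus 8\<close> show ?thesis
    unfolding self_dual_def proj_eq_def by (metis zero_neq_one)
qed

lemma octad_vector_all_nonzero:
  fixes p :: "'a::field coords"
  assumes "all_nonzero 4 7 p" and x: "\<And>i. i \<in> {1..7} \<Longrightarrow> octad_x p i \<noteq> 0"
  shows "all_nonzero 4 8 (octad_vector p)"
  unfolding all_nonzero_def
proof (intro allI impI, elim conjE)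
  fix J :: "nat set" assume J: "J \<subseteq> {1..8}" "card J = 4"
  show "octad_vector p J \<noteq> 0"
  proof (cases "8 \<in> J")
    case True
    define I where "I = {1..8} - J"
    have fin: "finite J" using J finite_subset by blast
    have "card I = 4" using J fin by (simp add: I_def card_Diff_subset)
    have I7: "I \<subseteq> {1..7}" using True by (intro subset_seven) (auto simp: I_def)
    then have "p I \<noteq> 0" using assms(1) \<open>card I = 4\<close> by (auto simp: all_nonzero_def)
    moreover have "(\<Prod>i\<in>I. octad_x p i) \<noteq> 0"
      using x I7 finite_subset[OF I7] by auto
    moreover have "concat_sign J I = 1 \<or> concat_sign J I = -1"
      using concat_sign_square[of J I] by (simp add: zmult_eq_1_iff)
    moreover have "octad_vector p J = of_int (concat_sign J I) * (p I / (\<Prod>i\<in>I. octad_x p i))"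
      using J True by (simp add: octad_vector_def I_def Let_def)
    ultimately show ?thesis by auto
  next
    case False
    have "J \<subseteq> {1..7}" using J False by (intro subset_seven)
    then show ?thesis using J False assms(1) by (auto simp: octad_vector_def all_nonzero_def)
  qed
qed

subsection \<open>Irreducibility of the Grassmannian\<close>

definition poly_fun :: "('a::comm_ring_1 \<Rightarrow> 'a) \<Rightarrow> bool" where
  "poly_fun f \<longleftrightarrow> (\<exists>q. \<forall>t. f t = poly q t)"

lemma poly_fun_const: "poly_fun (\<lambda>t. c)"
  unfolding poly_fun_def by (rule exI[of _ "[:c:]"]) simp

lemma poly_fun_ident: "poly_fun (\<lambda>t. t)"
  unfolding poly_fun_def by (rule exI[of _ "[:0, 1:]"]) simp

lemma poly_fun_add: "poly_fun f \<Longrightarrow> poly_fun g \<Longrightarrow> poly_fun (\<lambda>t. f t + g t)"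
  unfolding poly_fun_def by (metis poly_add)

lemma poly_fun_diff: "poly_fun f \<Longrightarrow> poly_fun g \<Longrightarrow> poly_fun (\<lambda>t. f t - g t)"
  unfolding poly_fun_def by (metis poly_diff)

lemma poly_fun_mult: "poly_fun f \<Longrightarrow> poly_fun g \<Longrightarrow> poly_fun (\<lambda>t. f t * g t)"
  unfolding poly_fun_def by (metis poly_mult)

text \<open>The product of two nonzero polynomials has finitely many roots, so an infinite field
  contains a non-root.\<close>

lemma poly_fun_common_nonzero:
  fixes f g :: "'a::field \<Rightarrow> 'a"
  assumes "infinite (UNIV :: 'a set)" "poly_fun f" "poly_fun g" "f a \<noteq> 0" "g b \<noteq> 0"
  obtains t where "f t \<noteq> 0" "g t \<noteq> 0"
proof -
  obtain q r where q: "\<And>t. f t = poly q t" and r: "\<And>t. g t = poly r t"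
    using assms(2,3) by (auto simp: poly_fun_def)
  have "q \<noteq> 0" "r \<noteq> 0" using assms(4,5) q r by auto
  then have "finite {t. poly (q * r) t = 0}" by (intro poly_roots_finite) simp
  then have "{t. poly (q * r) t = 0} \<noteq> UNIV" using assms(1) by metis
  then obtain t where "poly (q * r) t \<noteq> 0" by blast
  then show ?thesis using that[of t] q r by simp
qed

lemma poly_fun_plucker_line:
  fixes A B :: "'a::field mat"
  assumes "A \<in> carrier_mat 4 m" "B \<in> carrier_mat 4 m"
  shows "poly_fun (\<lambda>t. plucker 4 m (A + t \<cdot>\<^sub>m (B - A)) I)"
proof (cases "I \<subseteq> {1..m} \<and> card I = 4")
  case True
  then obtain i j k l where ijkl: "0 < i" "i < j" "j < k" "k < l" "l \<le> m" "I = {i, j, k, l}"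
    using four_subsetE[of I m] by metis
  have entry: "poly_fun (\<lambda>t. (A + t \<cdot>\<^sub>m (B - A)) $$ (r, s))" if "r < 4" "s < m" for r s
  proof -
    have "(A + t \<cdot>\<^sub>m (B - A)) $$ (r, s) = A $$ (r, s) + t * (B $$ (r, s) - A $$ (r, s))" for t
      using that assms by simp
    then show ?thesis
      by (simp only:) (intro poly_fun_add poly_fun_mult poly_fun_const poly_fun_ident)
  qed
  show ?thesis
    using ijkl unfolding ijkl(6)
    by (subst plucker_four)
      (auto simp only: det4_def intro!: poly_fun_add poly_fun_mult poly_fun_diff entry)
next
  case False
  then have "plucker 4 m M I = 0" for M :: "'a mat"
    by (auto simp: plucker_def)
  then show ?thesis by (simp only: poly_fun_const)
qed

lemma homog_poly_plucker_line:
  fixes A B :: "'a::field mat"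
  assumes "homog_poly d F" and AB: "A \<in> carrier_mat 4 m" "B \<in> carrier_mat 4 m"
  shows "poly_fun (\<lambda>t. F (plucker 4 m (A + t \<cdot>\<^sub>m (B - A))))"
  using assms(1)
  by induction (auto intro: poly_fun_const poly_fun_add poly_fun_mult poly_fun_plucker_line[OF AB])

text \<open>The witness ranges over all matrices, including those of lower rank, because the line
  joining two matrices need not stay inside the full-rank ones.\<close>

definition pl_nonzero :: "nat \<Rightarrow> ('a::field coords \<Rightarrow> 'a) \<Rightarrow> bool" where
  "pl_nonzero m F \<longleftrightarrow> (\<exists>d. homog_poly d F) \<and> (\<exists>A\<in>carrier_mat 4 m. F (plucker 4 m A) \<noteq> 0)"

lemma pl_nonzero_common:
  fixes F G :: "'a::field coords \<Rightarrow> 'a"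
  assumes inf: "infinite (UNIV :: 'a set)" and "pl_nonzero m F" "pl_nonzero m G"
  obtains A where "A \<in> carrier_mat 4 m" "F (plucker 4 m A) \<noteq> 0" "G (plucker 4 m A) \<noteq> 0"
proof -
  obtain d e A B where F: "homog_poly d F" "A \<in> carrier_mat 4 m" "F (plucker 4 m A) \<noteq> 0"
    and G: "homog_poly e G" "B \<in> carrier_mat 4 m" "G (plucker 4 m B) \<noteq> 0"
    using assms(2,3) by (auto simp: pl_nonzero_def)
  have "A + 0 \<cdot>\<^sub>m (B - A) = A" "A + 1 \<cdot>\<^sub>m (B - A) = B"
    using F(2) G(2) by (auto intro!: eq_matI)
  then obtain t where "F (plucker 4 m (A + t \<cdot>\<^sub>m (B - A))) \<noteq> 0" "G (plucker 4 m (A + t \<cdot>\<^sub>m (B - A))) \<noteq> 0"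
    using poly_fun_common_nonzero[OF inf homog_poly_plucker_line[OF F(1,2) G(2)]
        homog_poly_plucker_line[OF G(1) F(2) G(2)], of 0 1] F(3) G(3) by metis
  moreover have "A + t \<cdot>\<^sub>m (B - A) \<in> carrier_mat 4 m"
    using F(2) G(2) by (intro add_carrier_mat smult_carrier_mat minus_carrier_mat)
  ultimately show ?thesis using that by blast
qed

lemma pl_nonzero_mult:
  fixes F G :: "'a::field coords \<Rightarrow> 'a"
  assumes "infinite (UNIV :: 'a set)" "pl_nonzero m F" "pl_nonzero m G"
  shows "pl_nonzero m (\<lambda>p. F p * G p)"
proof -
  obtain A where "A \<in> carrier_mat 4 m" "F (plucker 4 m A) * G (plucker 4 m A) \<noteq> 0"
    using pl_nonzero_common[OF assms] by (metis mult_eq_0_iff)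
  moreover have "\<exists>d. homog_poly d (\<lambda>p. F p * G p)"
    using assms(2,3) homog_poly.mult unfolding pl_nonzero_def by blast
  ultimately show ?thesis unfolding pl_nonzero_def by blast
qed

lemma pl_nonzero_prod:
  fixes F :: "'b \<Rightarrow> 'a::field coords \<Rightarrow> 'a"
  assumes inf: "infinite (UNIV :: 'a set)" and "finite S" "\<And>s. s \<in> S \<Longrightarrow> pl_nonzero m (F s)"
  shows "pl_nonzero m (\<lambda>p. \<Prod>s\<in>S. F s p)"
  using assms(2,3)
proof (induction S rule: finite_induct)
  case empty
  have "homog_poly 0 (\<lambda>p::'a coords. 1)" by (rule homog_poly.const)
  then show ?case unfolding pl_nonzero_def by (auto intro!: bexI[of _ "0\<^sub>m 4 m"])
next
  case (insert s S)
  then show ?case by (simp add: pl_nonzero_mult[OF inf])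
qed

lemma for_general_GrI:
  fixes F :: "'a::field coords \<Rightarrow> 'a"
  assumes inf: "infinite (UNIV :: 'a set)" and F: "pl_nonzero m F"
    and zero: "F (\<lambda>I. 0) = 0"
    and P: "\<And>p. p \<in> Gr 4 m \<Longrightarrow> F p \<noteq> 0 \<Longrightarrow> P p"
  shows "for_general (Gr 4 m) P"
proof -
  let ?U = "{p \<in> Gr 4 m. F p \<noteq> 0}"
  have "zariski_open_in (Gr 4 m) ?U"
    using F unfolding zariski_open_in_def pl_nonzero_def by (intro exI[of _ "{F}"]) auto
  moreover have "zariski_dense_in (Gr 4 m) ?U"
    unfolding zariski_dense_in_def
  proof (intro allI impI, elim conjE)
    fix V :: "'a coords set" assume V: "zariski_open_in (Gr 4 m) V" "V \<noteq> {}"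
    then obtain p G d where G: "homog_poly d G" "p \<in> Gr 4 m" "G p \<noteq> 0"
      and sub: "\<And>q. q \<in> Gr 4 m \<Longrightarrow> G q \<noteq> 0 \<Longrightarrow> q \<in> V"
      unfolding zariski_open_in_def by blast
    then have "pl_nonzero m G" unfolding pl_nonzero_def Gr_def by blast
    then obtain A where A: "A \<in> carrier_mat 4 m" "F (plucker 4 m A) \<noteq> 0" "G (plucker 4 m A) \<noteq> 0"
      using pl_nonzero_common[OF inf F] by metis
    \<comment> \<open>Since \<open>F\<close> vanishes at the zero vector, the matrix found on the
      line has full rank and gives a point of the Grassmannian.\<close>
    then have "plucker 4 m A \<noteq> (\<lambda>I. 0)" using zero by metis
    then have "\<exists>I. plucker 4 m A I \<noteq> 0" by (auto simp: fun_eq_iff)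
    then have "plucker 4 m A \<in> Gr 4 m" using A(1) unfolding Gr_def by blast
    then show "?U \<inter> V \<noteq> {}" using A sub by blast
  qed
  ultimately show ?thesis unfolding for_general_def using P by blast
qed

lemma pl_nonzero_coord:
  assumes "I \<subseteq> {1..m}" "card I = 4"
  shows "pl_nonzero m (\<lambda>p::'a::field coords. p I)"
proof -
  obtain i j k l where ijkl: "0 < i" "i < j" "j < k" "k < l" "l \<le> m" "I = {i, j, k, l}"
    using four_subsetE[OF assms] by metis
  let ?A = "mat 4 m (\<lambda>(r, s). if s = [i - 1, j - 1, k - 1, l - 1] ! r then 1 else 0 :: 'a)"
  have "plucker 4 m ?A I = 1"
  proof -
    have "i - 1 < m" "j - 1 < m" "k - 1 < m" "l - 1 < m" "i - 1 < j - 1" "j - 1 < k - 1" "k - 1 < l - 1"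
      using ijkl by auto
    then show ?thesis
      unfolding ijkl(6) plucker_four[OF ijkl(1-5)] det4_def by (simp del: One_nat_def)
  qed
  moreover have "homog_poly 1 (\<lambda>p::'a coords. p I)" by (rule homog_poly.coord)
  ultimately show ?thesis unfolding pl_nonzero_def
    by (metis mat_carrier zero_neq_one)
qed

lemma homog_poly_product4_diff:
  "homog_poly 4 (\<lambda>p::'a::field coords. p A * p B * p C * p D - p A' * p B' * p C' * p D')"
proof -
  have four: "homog_poly 4 (\<lambda>p::'a coords. p A * p B * p C * p D)" for A B C D
    using homog_poly.mult[OF homog_poly.mult[OF homog_poly.mult[OF homog_poly.coord homog_poly.coord]
          homog_poly.coord] homog_poly.coord, of A B C D] by (simp add: eval_nat_numeral)
  have "homog_poly 4 (\<lambda>p::'a coords. p A * p B * p C * p D + (-1) * (p A' * p B' * p C' * p D'))"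
    by (rule homog_poly.add[OF four homog_poly.mult[OF homog_poly.const four, unfolded add_0]])
  then show ?thesis by simp
qed

text \<open>
  Seven columns at which the polynomial \<open>octad_x p i\<close> is $\pm 1$ over the integers, hence nonzero in
  every characteristic.
\<close>

definition witness :: "nat \<Rightarrow> 'a::field list list" where
  "witness i = [[1,0,0,0], [0,1,0,0], [0,0,1,0], [0,0,0,1]] @
    [[[0,0,1,1], [0,1,0,1], [0,1,1,0]],
     [[0,0,1,1], [1,0,0,1], [1,0,1,0]],
     [[0,1,0,1], [1,0,0,1], [1,1,0,0]],
     [[0,1,1,0], [1,0,1,0], [1,1,0,0]],
     [[0,1,1,1], [1,0,0,1], [1,0,1,0]],
     [[0,0,1,1], [1,1,0,1], [0,1,1,0]],
     [[0,0,1,1], [0,1,0,1], [1,1,1,0]]] ! (i - 1)"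

lemma pl_nonzero_octad_x:
  assumes "i \<in> {1..7}"
  shows "pl_nonzero 7 (\<lambda>p::'a::field coords. octad_x p i)"
proof -
  have "{1..7} = {1, 2, 3, 4, 5, 6, 7::nat}" by auto
  with assms have i: "i \<in> {1, 2, 3, 4, 5, 6, 7}" by blast
  let ?W = "\<lambda>i. cols_mat 7 (witness i) :: 'a mat"
  have "octad_x (plucker 4 7 (?W 1)) 1 = 1"
    by (simp add: octad_x_def plucker_cols_mat witness_def det4_lists)
  moreover have "octad_x (plucker 4 7 (?W 2)) 2 = -1"
    by (simp add: octad_x_def plucker_cols_mat witness_def det4_lists)
  moreover have "octad_x (plucker 4 7 (?W 3)) 3 = 1"
    by (simp add: octad_x_def plucker_cols_mat witness_def det4_lists)
  moreover have "octad_x (plucker 4 7 (?W 4)) 4 = -1"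
    by (simp add: octad_x_def plucker_cols_mat witness_def det4_lists)
  moreover have "octad_x (plucker 4 7 (?W 5)) 5 = 1"
    by (simp add: octad_x_def plucker_cols_mat witness_def det4_lists)
  moreover have "octad_x (plucker 4 7 (?W 6)) 6 = -1"
    by (simp add: octad_x_def plucker_cols_mat witness_def det4_lists)
  moreover have "octad_x (plucker 4 7 (?W 7)) 7 = -1"
    by (simp add: octad_x_def plucker_cols_mat witness_def det4_lists)
  ultimately have nz: "octad_x (plucker 4 7 (?W i)) i \<noteq> 0"
    using i by (elim insertE) simp_all
  have hom: "homog_poly 4 (\<lambda>p::'a coords. octad_x p i)"
    using i by (elim insertE) (simp_all add: octad_x_def homog_poly_product4_diff)
  have "?W i \<in> carrier_mat 4 7" by (rule cols_mat_carrier)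
  with nz hom show ?thesis unfolding pl_nonzero_def by blast
qed

subsection \<open>Normal form of seven points\<close>

text \<open>Six parameters, the dimension 21 - 15 of seven points modulo projective transformations:
  the points 6 and 7 have first coordinate scaled to 1, and \<open>a, b, c\<close> and
  \<open>d, e, f\<close> are their remaining coordinates.\<close>

locale normal_form =
  fixes a b c d e f :: "'a::field"
begin

definition W :: "'a list list" where
  "W = [[1, 0, 0, 0], [0, 1, 0, 0], [0, 0, 1, 0], [0, 0, 0, 1], [1, 1, 1, 1], [1, a, b, c], [1, d, e, f]]"

definition p :: "'a coords" where
  "p = plucker 4 7 (cols_mat 7 W)"

definition x :: "nat \<Rightarrow> 'a" where
  "x = octad_x p"

lemma p_eqs:
  "p {1, 2, 3, 4} = 1"
  "p {1, 2, 3, 5} = 1"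
  "p {1, 2, 3, 6} = c"
  "p {1, 2, 3, 7} = f"
  "p {1, 2, 4, 5} = - 1"
  "p {1, 2, 4, 6} = - b"
  "p {1, 2, 4, 7} = - e"
  "p {1, 2, 5, 6} = (c - b)"
  "p {1, 2, 5, 7} = (f - e)"
  "p {1, 2, 6, 7} = (b * f - c * e)"
  "p {1, 3, 4, 5} = 1"
  "p {1, 3, 4, 6} = a"
  "p {1, 3, 4, 7} = d"
  "p {1, 3, 5, 6} = - (c - a)"
  "p {1, 3, 5, 7} = - (f - d)"
  "p {1, 3, 6, 7} = - (a * f - c * d)"
  "p {1, 4, 5, 6} = (b - a)"
  "p {1, 4, 5, 7} = (e - d)"
  "p {1, 4, 6, 7} = (a * e - b * d)"
  "p {1, 5, 6, 7} = ((b * f - c * e) - (a * f - c * d) + (a * e - b * d))"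
  "p {2, 3, 4, 5} = - 1"
  "p {2, 3, 4, 6} = - 1"
  "p {2, 3, 4, 7} = - 1"
  "p {2, 3, 5, 6} = (c - 1)"
  "p {2, 3, 5, 7} = (f - 1)"
  "p {2, 3, 6, 7} = (f - c)"
  "p {2, 4, 5, 6} = - (b - 1)"
  "p {2, 4, 5, 7} = - (e - 1)"
  "p {2, 4, 6, 7} = - (e - b)"
  "p {2, 5, 6, 7} = - ((b * f - c * e) - (f - c) + (e - b))"
  "p {3, 4, 5, 6} = (a - 1)"
  "p {3, 4, 5, 7} = (d - 1)"
  "p {3, 4, 6, 7} = (d - a)"
  "p {3, 5, 6, 7} = ((a * f - c * d) - (f - c) + (d - a))"
  "p {4, 5, 6, 7} = - ((a * e - b * d) - (e - b) + (d - a))"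
  by (simp_all add: p_def plucker_cols_mat W_def det4_lists algebra_simps)

text \<open>Only the first four are expanded. The last three already have the form of the diagonal
  entries of $C^T X C$ in the columns 5, 6 and 7.\<close>

lemma x_eqs:
  "x 1 = - a * c * e * f + b * c * d * f + a * c * d * e + a * b * e * f - b * c * d * e - a * b * d * f"
  "x 2 = b * c * e + b * f + c * e * f - b * c * f - c * e - b * e * f"
  "x 3 = - c * d * f + a * c * f + c * d + a * d * f - a * c * d - a * f"
  "x 4 = a * b * d + a * e + b * d * e - a * b * e - b * d - a * d * e"
  "x 5 = - (x 1 + x 2 + x 3 + x 4)"
  "x 6 = - (x 1 + a * a * x 2 + b * b * x 3 + c * c * x 4)"
  "x 7 = - (x 1 + d * d * x 2 + e * e * x 3 + f * f * x 4)"
  by (simp_all add: x_def octad_x_def p_eqs algebra_simps del: One_nat_def)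

text \<open>The off-diagonal entries of $C^T X C$ in the columns 5, 6 and 7. They explain the
  formulas: up to alternating signs, \<open>x 1\<close>, ..., \<open>x 4\<close> are the maximal
  minors of this system of three linear equations in four unknowns.\<close>

lemma x_orthogonal:
  "x 1 + a * x 2 + b * x 3 + c * x 4 = 0"
  "x 1 + d * x 2 + e * x 3 + f * x 4 = 0"
  "x 1 + a * d * x 2 + b * e * x 3 + c * f * x 4 = 0"
  by (simp_all add: x_eqs(1-4) algebra_simps del: One_nat_def)

text \<open>
  The factors \<open>1\<close> are coordinates of the points 5, 6 and 7; keeping them gives all relations the shape
  required by the expansion of the minors of the octad along one column.
\<close>

lemma two_row_relations:
  "1 * p {2, 5, 6, 7} * x 1 - 1 * p {1, 5, 6, 7} * x 2 = p {1, 2, 6, 7} * x 5"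
  "1 * p {3, 5, 6, 7} * x 1 - 1 * p {1, 5, 6, 7} * x 3 = p {1, 3, 6, 7} * x 5"
  "1 * p {4, 5, 6, 7} * x 1 - 1 * p {1, 5, 6, 7} * x 4 = p {1, 4, 6, 7} * x 5"
  "1 * p {3, 5, 6, 7} * x 2 - 1 * p {2, 5, 6, 7} * x 3 = p {2, 3, 6, 7} * x 5"
  "1 * p {4, 5, 6, 7} * x 2 - 1 * p {2, 5, 6, 7} * x 4 = p {2, 4, 6, 7} * x 5"
  "1 * p {4, 5, 6, 7} * x 3 - 1 * p {3, 5, 6, 7} * x 4 = p {3, 4, 6, 7} * x 5"
  "1 * p {2, 5, 6, 7} * x 1 - a * p {1, 5, 6, 7} * x 2 = - p {1, 2, 5, 7} * x 6"
  "1 * p {3, 5, 6, 7} * x 1 - b * p {1, 5, 6, 7} * x 3 = - p {1, 3, 5, 7} * x 6"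
  "1 * p {4, 5, 6, 7} * x 1 - c * p {1, 5, 6, 7} * x 4 = - p {1, 4, 5, 7} * x 6"
  "a * p {3, 5, 6, 7} * x 2 - b * p {2, 5, 6, 7} * x 3 = - p {2, 3, 5, 7} * x 6"
  "a * p {4, 5, 6, 7} * x 2 - c * p {2, 5, 6, 7} * x 4 = - p {2, 4, 5, 7} * x 6"
  "b * p {4, 5, 6, 7} * x 3 - c * p {3, 5, 6, 7} * x 4 = - p {3, 4, 5, 7} * x 6"
  "1 * p {2, 5, 6, 7} * x 1 - d * p {1, 5, 6, 7} * x 2 = p {1, 2, 5, 6} * x 7"
  "1 * p {3, 5, 6, 7} * x 1 - e * p {1, 5, 6, 7} * x 3 = p {1, 3, 5, 6} * x 7"
  "1 * p {4, 5, 6, 7} * x 1 - f * p {1, 5, 6, 7} * x 4 = p {1, 4, 5, 6} * x 7"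
  "d * p {3, 5, 6, 7} * x 2 - e * p {2, 5, 6, 7} * x 3 = p {2, 3, 5, 6} * x 7"
  "d * p {4, 5, 6, 7} * x 2 - f * p {2, 5, 6, 7} * x 4 = p {2, 4, 5, 6} * x 7"
  "e * p {4, 5, 6, 7} * x 3 - f * p {3, 5, 6, 7} * x 4 = p {3, 4, 5, 6} * x 7"
  unfolding p_eqs x_eqs by (simp_all add: algebra_simps)

text \<open>The middle factors are the signed values of the two-row minors on columns 6, 8 or 7, 8.
  Each identity thus expands a three-row minor along column 5 or 6 with its cofactors already
  evaluated.\<close>

lemma three_row_relations:
  "1 * (- p {2, 3, 5, 7}) * x 1 - 1 * (- p {1, 3, 5, 7}) * x 2 + 1 * (- p {1, 2, 5, 7}) * x 3 = p {1, 2, 3, 7} * x 5"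
  "1 * (- p {2, 4, 5, 7}) * x 1 - 1 * (- p {1, 4, 5, 7}) * x 2 + 1 * (- p {1, 2, 5, 7}) * x 4 = p {1, 2, 4, 7} * x 5"
  "1 * (- p {3, 4, 5, 7}) * x 1 - 1 * (- p {1, 4, 5, 7}) * x 3 + 1 * (- p {1, 3, 5, 7}) * x 4 = p {1, 3, 4, 7} * x 5"
  "1 * (- p {3, 4, 5, 7}) * x 2 - 1 * (- p {2, 4, 5, 7}) * x 3 + 1 * (- p {2, 3, 5, 7}) * x 4 = p {2, 3, 4, 7} * x 5"
  "1 * (p {2, 3, 5, 6}) * x 1 - 1 * (p {1, 3, 5, 6}) * x 2 + 1 * (p {1, 2, 5, 6}) * x 3 = - p {1, 2, 3, 6} * x 5"
  "1 * (p {2, 4, 5, 6}) * x 1 - 1 * (p {1, 4, 5, 6}) * x 2 + 1 * (p {1, 2, 5, 6}) * x 4 = - p {1, 2, 4, 6} * x 5"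
  "1 * (p {3, 4, 5, 6}) * x 1 - 1 * (p {1, 4, 5, 6}) * x 3 + 1 * (p {1, 3, 5, 6}) * x 4 = - p {1, 3, 4, 6} * x 5"
  "1 * (p {3, 4, 5, 6}) * x 2 - 1 * (p {2, 4, 5, 6}) * x 3 + 1 * (p {2, 3, 5, 6}) * x 4 = - p {2, 3, 4, 6} * x 5"
  "1 * (p {2, 3, 5, 6}) * x 1 - a * (p {1, 3, 5, 6}) * x 2 + b * (p {1, 2, 5, 6}) * x 3 = p {1, 2, 3, 5} * x 6"
  "1 * (p {2, 4, 5, 6}) * x 1 - a * (p {1, 4, 5, 6}) * x 2 + c * (p {1, 2, 5, 6}) * x 4 = p {1, 2, 4, 5} * x 6"
  "1 * (p {3, 4, 5, 6}) * x 1 - b * (p {1, 4, 5, 6}) * x 3 + c * (p {1, 3, 5, 6}) * x 4 = p {1, 3, 4, 5} * x 6"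
  "a * (p {3, 4, 5, 6}) * x 2 - b * (p {2, 4, 5, 6}) * x 3 + c * (p {2, 3, 5, 6}) * x 4 = p {2, 3, 4, 5} * x 6"
  unfolding p_eqs x_eqs by (simp_all add: algebra_simps)

text \<open>The cofactors of column 5 evaluate to coordinates that are plus or minus 1, so this is
  the formula for \<open>x 5\<close> in \<open>x_eqs\<close>.\<close>

lemma four_row_relation:
  "1 * (p {2, 3, 4, 5}) * x 1 - 1 * (p {1, 3, 4, 5}) * x 2 + 1 * (p {1, 2, 4, 5}) * x 3 - 1 * (p {1, 2, 3, 5}) * x 4 = p {1, 2, 3, 4} * x 5"
  unfolding p_eqs x_eqs(5) by simp

text \<open>The cross product of the coefficient vectors of the two linear equations for
  \<open>s * t\<close>, \<open>s * u\<close>, \<open>t * u\<close>; it spans their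
  solutions.\<close>

lemma cross_product_relations:
  "(1 - c) * (a - b) * ((1 - e) * (d - f)) - (1 - f) * (d - e) * ((1 - b) * (a - c)) = - x 5"
  "(1 - c) * (a - b) * ((e - b) * (a * f - c * d)) - (f - c) * (a * e - b * d) * ((1 - b) * (a - c)) = x 6"
  "(1 - f) * (d - e) * ((e - b) * (a * f - c * d)) - (f - c) * (a * e - b * d) * ((1 - e) * (d - f)) = - x 7"
  unfolding x_eqs by (simp_all add: algebra_simps)

end

subsection \<open>The eighth point\<close>

text \<open>One step in building up the minors. The column with entries \<open>Cr\<close>,
  \<open>Cs\<close> and weight \<open>y\<close> joins the column of the eighth point, so
  \<open>y\<close> leaves the product of weights over the complement. Clearing the denominators of
  the smaller minors leaves an identity with the common factor \<open>y\<close>, which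
  cancels.\<close>

lemma two_row_minor:
  fixes y :: "'a::field"
  assumes "Cr * ms * xr - Cs * mr * xs = P * y" "y \<noteq> 0"
    "vr * (xr * (y * k * l)) = mr" "vs * (xs * (y * k * l)) = ms"
  shows "(Cr * vs - Cs * vr) * (xr * xs * k * l) = P"
proof -
  have "(Cr * vs - Cs * vr) * (xr * xs * k * l) * y = P * y"
    unfolding assms(1)[symmetric] assms(3,4)[symmetric] by (simp add: algebra_simps)
  then show ?thesis using assms(2) by simp
qed

lemma three_row_minor:
  fixes y :: "'a::field"
  assumes "Cq * Eq * xq - Cr * Er * xr + Cs * Es * xs = P * y" "y \<noteq> 0"
    "Dq * (xr * xs * y * z) = Eq" "Dr * (xq * xs * y * z) = Er" "Ds * (xq * xr * y * z) = Es"
  shows "(Cq * Dq - Cr * Dr + Cs * Ds) * (xq * xr * xs * z) = P"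
proof -
  have "(Cq * Dq - Cr * Dr + Cs * Ds) * (xq * xr * xs * z) * y = P * y"
    unfolding assms(1)[symmetric] assms(3-5)[symmetric] by (simp add: algebra_simps)
  then show ?thesis using assms(2) by simp
qed

text \<open>For the columns 6, 7, 8, where the weight of the new column 6 comes after
  \<open>x 5\<close> in the products attached to the two-row minors.\<close>

lemma three_row_minor_commuted:
  fixes y :: "'a::field"
  assumes "Cq * Eq * xq - Cr * Er * xr + Cs * Es * xs = P * y" "y \<noteq> 0"
    "Dq * (xr * xs * z * y) = Eq" "Dr * (xq * xs * z * y) = Er" "Ds * (xq * xr * z * y) = Es"
  shows "(Cq * Dq - Cr * Dr + Cs * Ds) * (xq * xr * xs * z) = P"
  by (rule three_row_minor[OF assms(1,2)]) (simp_all add: assms(3-5)[symmetric] mult_ac)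

lemma four_row_minor:
  fixes y :: "'a::field"
  assumes "Cq * Eq * xq - Cr * Er * xr + Cs * Es * xs - Ct * Et * xt = P * y" "y \<noteq> 0"
    "Dq * (xr * xs * xt * y) = Eq" "Dr * (xq * xs * xt * y) = Er"
    "Ds * (xq * xr * xt * y) = Es" "Dt * (xq * xr * xs * y) = Et"
  shows "(Cq * Dq - Cr * Dr + Cs * Ds - Ct * Dt) * (xq * xr * xs * xt) = P"
proof -
  have "(Cq * Dq - Cr * Dr + Cs * Ds - Ct * Dt) * (xq * xr * xs * xt) * y = P * y"
    unfolding assms(1)[symmetric] assms(3-6)[symmetric] by (simp add: algebra_simps)
  then show ?thesis using assms(2) by simp
qed

text \<open>\<open>B\<close> is a minor of the matrix $C$ and \<open>E\<close> its cleared value.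
  \<open>s\<close> is the sign produced by the unit columns among the points 1 to 4 when the Plucker
  coordinate is reduced to \<open>B\<close>. What remains in each case is to compare
  \<open>s\<close> with an explicit inversion count.\<close>

lemma octad_vector_eqI:
  fixes p :: "'a::field coords"
  assumes B: "B * (octad_x p i1 * octad_x p i2 * octad_x p i3 * octad_x p i4) = E"
    and q: "q = s * B" and E: "s * E = (-1) ^ inversions [j1, j2, j3, 8, i1, i2, i3, i4] * p {i1, i2, i3, i4}"
    and x: "\<And>i. i \<in> {1..7} \<Longrightarrow> octad_x p i \<noteq> 0"
    and lt: "0 < j1" "j1 < j2" "j2 < j3" "j3 < 8" "0 < i1" "i1 < i2" "i2 < i3" "i3 < i4" "i4 < 8"
    and dist: "distinct [j1, j2, j3, i1, i2, i3, i4]"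
  shows "octad_vector p {j1, j2, j3, 8} = q"
proof -
  let ?J = "{j1, j2, j3, 8}" and ?I = "{i1, i2, i3, i4}"
  have U: "?J \<union> ?I = {1..8}"
  proof (rule card_subset_eq)
    have "card (set [j1, j2, j3, 8, i1, i2, i3, i4]) = 8"
      using lt dist by (subst distinct_card) auto
    moreover have "set [j1, j2, j3, 8, i1, i2, i3, i4] = ?J \<union> ?I" by auto
    ultimately show "card (?J \<union> ?I) = card {1..8::nat}" by simp
  qed (use lt in auto)
  have disj: "?J \<inter> ?I = {}" using lt dist by auto
  then have I: "{1..8} - ?J = ?I" unfolding U[symmetric] by blast
  have cards: "card ?J = 4" "card ?I = 4" using lt by (auto intro: card_four)
  have "?J \<union> ?I = {1..card ?J + card ?I}" unfolding cards U by simp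
  then have "concat_sign ?J ?I = (-1) ^ inversions (sorted_list_of_set ?J @ sorted_list_of_set ?I)"
    by (intro concat_sign_inversions disj) simp_all
  also have "sorted_list_of_set ?J @ sorted_list_of_set ?I = [j1, j2, j3, 8, i1, i2, i3, i4]"
    using lt by (simp add: sorted_list_of_set_four)
  finally have sgn: "concat_sign ?J ?I = (-1) ^ inversions [j1, j2, j3, 8, i1, i2, i3, i4]" .
  let ?X = "octad_x p i1 * octad_x p i2 * octad_x p i3 * octad_x p i4"
  have "?X \<noteq> 0" using x lt by simp
  have X: "(\<Prod>i\<in>?I. octad_x p i) = ?X" using lt by (simp add: mult_ac)
  have "?J \<subseteq> {1..8}" using U by blast
  then have "octad_vector p ?J = of_int (concat_sign ?J ?I) * (p ?I / ?X)"
    unfolding octad_vector_def I Let_def X by (simp only: cards simp_thms if_True insert_iff)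
  also have "\<dots> = s * E / ?X"
    unfolding sgn E by (simp only: of_int_power of_int_minus of_int_1 times_divide_eq_right)
  also have "\<dots> = q" using \<open>?X \<noteq> 0\<close> unfolding q B[symmetric] by simp
  finally show ?thesis .
qed

lemma sum_lessThan_four: "(\<Sum>r<(4::nat). g r) = g 0 + g 1 + g 2 + (g 3 :: 'a::comm_monoid_add)"
  by (simp add: eval_nat_numeral add.assoc)

text \<open>The matrices $A = C^T X$ and $B = -C Y^{-1}$ satisfy $AB = 1$, hence $BA = 1$ since they
  are square. The latter says $C Y^{-1} C^T = -X^{-1}$, which has no off-diagonal entries.\<close>

lemma diagonal_congruence_inverse:
  fixes C :: "nat \<Rightarrow> nat \<Rightarrow> 'a::field"
  assumes CXC: "\<And>k l. k < n \<Longrightarrow> l < n \<Longrightarrow> (\<Sum>r<n. C r k * C r l * X r) = (if k = l then - Y k else 0)"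
    and Y: "\<And>k. k < n \<Longrightarrow> Y k \<noteq> 0" and X: "\<And>r. r < n \<Longrightarrow> X r \<noteq> 0"
    and "r < n" "s < n" "r \<noteq> s"
  shows "(\<Sum>k<n. C r k * C s k / Y k) = 0"
proof -
  define A where "A = mat n n (\<lambda>(k, r). C r k * X r)"
  define B where "B = mat n n (\<lambda>(r, k). - C r k / Y k)"
  have AB: "A \<in> carrier_mat n n" "B \<in> carrier_mat n n" by (simp_all add: A_def B_def)
  have "A * B = 1\<^sub>m n"
  proof (rule eq_matI)
    fix k l assume "k < dim_row (1\<^sub>m n)" "l < dim_col (1\<^sub>m n)"
    then have kl: "k < n" "l < n" by auto
    have "(A * B) $$ (k, l) = (\<Sum>r<n. C r k * X r * (- C r l / Y l))"
      using kl by (simp add: A_def B_def scalar_prod_def atLeast0LessThan)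
    also have "\<dots> = (\<Sum>r<n. C r k * C r l * X r) * (- 1 / Y l)"
      unfolding sum_distrib_right by (intro sum.cong) (simp_all add: field_simps)
    also have "\<dots> = 1\<^sub>m n $$ (k, l)" using CXC[OF kl] kl Y by simp
    finally show "(A * B) $$ (k, l) = 1\<^sub>m n $$ (k, l)" .
  qed (simp_all add: A_def B_def)
  then have "B * A = 1\<^sub>m n" by (rule mat_mult_left_right_inverse[OF AB])
  then have "(B * A) $$ (r, s) = 0" using assms(4-6) by simp
  moreover have "(B * A) $$ (r, s) = (\<Sum>k<n. - C r k / Y k * (C s k * X s))"
    using assms(4,5) by (simp add: A_def B_def scalar_prod_def atLeast0LessThan)
  moreover have "\<dots> = (\<Sum>k<n. C r k * C s k / Y k) * (- X s)"
    unfolding sum_distrib_right by (intro sum.cong) simp_all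
  ultimately show ?thesis using X[of s] assms(5) by simp
qed

context normal_form
begin

text \<open>The coordinates of the eighth point are forced by \<open>I\<^sup>c = {1, 2, 3, 4, 8} - {r}\<close> in the formula.\<close>

definition v :: "nat \<Rightarrow> 'a" where
  "v r = p {r, 5, 6, 7} / (x r * x 5 * x 6 * x 7)"

definition octad_mat :: "'a mat" where
  "octad_mat = cols_mat 8 (W @ [[v 1, v 2, v 3, v 4]])"

end

locale general_normal_form = normal_form +
  assumes x_nz: "\<And>i. i \<in> {1..7} \<Longrightarrow> x i \<noteq> 0"
    and p_nz: "all_nonzero 4 7 p"
begin

lemma two_row_minors:
  "(1 * v 2 - 1 * v 1) * (x 1 * x 2 * x 6 * x 7) = p {1, 2, 6, 7}"
  "(1 * v 3 - 1 * v 1) * (x 1 * x 3 * x 6 * x 7) = p {1, 3, 6, 7}"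
  "(1 * v 4 - 1 * v 1) * (x 1 * x 4 * x 6 * x 7) = p {1, 4, 6, 7}"
  "(1 * v 3 - 1 * v 2) * (x 2 * x 3 * x 6 * x 7) = p {2, 3, 6, 7}"
  "(1 * v 4 - 1 * v 2) * (x 2 * x 4 * x 6 * x 7) = p {2, 4, 6, 7}"
  "(1 * v 4 - 1 * v 3) * (x 3 * x 4 * x 6 * x 7) = p {3, 4, 6, 7}"
  "(1 * v 2 - a * v 1) * (x 1 * x 2 * x 5 * x 7) = - p {1, 2, 5, 7}"
  "(1 * v 3 - b * v 1) * (x 1 * x 3 * x 5 * x 7) = - p {1, 3, 5, 7}"
  "(1 * v 4 - c * v 1) * (x 1 * x 4 * x 5 * x 7) = - p {1, 4, 5, 7}"
  "(a * v 3 - b * v 2) * (x 2 * x 3 * x 5 * x 7) = - p {2, 3, 5, 7}"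
  "(a * v 4 - c * v 2) * (x 2 * x 4 * x 5 * x 7) = - p {2, 4, 5, 7}"
  "(b * v 4 - c * v 3) * (x 3 * x 4 * x 5 * x 7) = - p {3, 4, 5, 7}"
  "(1 * v 2 - d * v 1) * (x 1 * x 2 * x 5 * x 6) = p {1, 2, 5, 6}"
  "(1 * v 3 - e * v 1) * (x 1 * x 3 * x 5 * x 6) = p {1, 3, 5, 6}"
  "(1 * v 4 - f * v 1) * (x 1 * x 4 * x 5 * x 6) = p {1, 4, 5, 6}"
  "(d * v 3 - e * v 2) * (x 2 * x 3 * x 5 * x 6) = p {2, 3, 5, 6}"
  "(d * v 4 - f * v 2) * (x 2 * x 4 * x 5 * x 6) = p {2, 4, 5, 6}"
  "(e * v 4 - f * v 3) * (x 3 * x 4 * x 5 * x 6) = p {3, 4, 5, 6}"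
  \<comment> \<open>The unknowns \<open>y\<close>, \<open>mr\<close>, \<open>ms\<close> of the rule
    do not occur in the goal; unification with the matching relation determines them.\<close>
  by (rule two_row_minor, rule two_row_relations, simp add: x_nz, simp add: v_def x_nz mult_ac, simp add: v_def x_nz mult_ac)+

lemma three_row_minors:
  "(1 * (a * v 3 - b * v 2) - 1 * (1 * v 3 - b * v 1) + 1 * (1 * v 2 - a * v 1)) * (x 1 * x 2 * x 3 * x 7) = p {1, 2, 3, 7}"
  "(1 * (a * v 4 - c * v 2) - 1 * (1 * v 4 - c * v 1) + 1 * (1 * v 2 - a * v 1)) * (x 1 * x 2 * x 4 * x 7) = p {1, 2, 4, 7}"
  "(1 * (b * v 4 - c * v 3) - 1 * (1 * v 4 - c * v 1) + 1 * (1 * v 3 - b * v 1)) * (x 1 * x 3 * x 4 * x 7) = p {1, 3, 4, 7}"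
  "(1 * (b * v 4 - c * v 3) - 1 * (a * v 4 - c * v 2) + 1 * (a * v 3 - b * v 2)) * (x 2 * x 3 * x 4 * x 7) = p {2, 3, 4, 7}"
  "(1 * (d * v 3 - e * v 2) - 1 * (1 * v 3 - e * v 1) + 1 * (1 * v 2 - d * v 1)) * (x 1 * x 2 * x 3 * x 6) = - p {1, 2, 3, 6}"
  "(1 * (d * v 4 - f * v 2) - 1 * (1 * v 4 - f * v 1) + 1 * (1 * v 2 - d * v 1)) * (x 1 * x 2 * x 4 * x 6) = - p {1, 2, 4, 6}"
  "(1 * (e * v 4 - f * v 3) - 1 * (1 * v 4 - f * v 1) + 1 * (1 * v 3 - e * v 1)) * (x 1 * x 3 * x 4 * x 6) = - p {1, 3, 4, 6}"
  "(1 * (e * v 4 - f * v 3) - 1 * (d * v 4 - f * v 2) + 1 * (d * v 3 - e * v 2)) * (x 2 * x 3 * x 4 * x 6) = - p {2, 3, 4, 6}"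
  "(1 * (d * v 3 - e * v 2) - a * (1 * v 3 - e * v 1) + b * (1 * v 2 - d * v 1)) * (x 1 * x 2 * x 3 * x 5) = p {1, 2, 3, 5}"
  "(1 * (d * v 4 - f * v 2) - a * (1 * v 4 - f * v 1) + c * (1 * v 2 - d * v 1)) * (x 1 * x 2 * x 4 * x 5) = p {1, 2, 4, 5}"
  "(1 * (e * v 4 - f * v 3) - b * (1 * v 4 - f * v 1) + c * (1 * v 3 - e * v 1)) * (x 1 * x 3 * x 4 * x 5) = p {1, 3, 4, 5}"
  "(a * (e * v 4 - f * v 3) - b * (d * v 4 - f * v 2) + c * (d * v 3 - e * v 2)) * (x 2 * x 3 * x 4 * x 5) = p {2, 3, 4, 5}"
  by (rule three_row_minor, rule three_row_relations, simp add: x_nz, (rule two_row_minors)+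
    | rule three_row_minor_commuted, rule three_row_relations, simp add: x_nz, (rule two_row_minors)+)+

lemma full_minor:
  "(1 * (a * (e * v 4 - f * v 3) - b * (d * v 4 - f * v 2) + c * (d * v 3 - e * v 2)) - 1 * (1 * (e * v 4 - f * v 3) - b * (1 * v 4 - f * v 1) + c * (1 * v 3 - e * v 1)) + 1 * (1 * (d * v 4 - f * v 2) - a * (1 * v 4 - f * v 1) + c * (1 * v 2 - d * v 1)) - 1 * (1 * (d * v 3 - e * v 2) - a * (1 * v 3 - e * v 1) + b * (1 * v 2 - d * v 1))) * (x 1 * x 2 * x 3 * x 4) = p {1, 2, 3, 4}"
  by (rule four_row_minor, rule four_row_relation, simp add: x_nz, (rule three_row_minors)+)

lemma one_row_minors:
  "v 1 * (x 1 * x 5 * x 6 * x 7) = p {1, 5, 6, 7}"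
  "v 2 * (x 2 * x 5 * x 6 * x 7) = p {2, 5, 6, 7}"
  "v 3 * (x 3 * x 5 * x 6 * x 7) = p {3, 5, 6, 7}"
  "v 4 * (x 4 * x 5 * x 6 * x 7) = p {4, 5, 6, 7}"
  by (simp_all add: v_def x_nz)

text \<open>Each of the points 1 to 4 among \<open>i, j, k\<close> deletes a row of $C$, so the
  minor has as many rows as the index set has elements among 5, ..., 8. The rows kept and the
  columns deleted form the complement.\<close>

lemma octad_vector_eighth:
  assumes ijk: "0 < i" "i < j" "j < k" "k < 8"
  shows "octad_vector p {i, j, k, 8} = plucker 4 8 octad_mat {i, j, k, 8}"
proof -
  note eqI = octad_vector_eqI[where p = p, folded x_def]
  note ev = octad_mat_def plucker_cols_mat W_def det4_lists algebra_simps x_nz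
  have h123: "octad_vector p {1, 2, 3, 8} = plucker 4 8 octad_mat {1, 2, 3, 8}"
    by (rule eqI[OF one_row_minors(4), where s = "1"]) (simp_all add: ev del: One_nat_def)
  have h124: "octad_vector p {1, 2, 4, 8} = plucker 4 8 octad_mat {1, 2, 4, 8}"
    by (rule eqI[OF one_row_minors(3), where s = "-1"]) (simp_all add: ev del: One_nat_def)
  have h125: "octad_vector p {1, 2, 5, 8} = plucker 4 8 octad_mat {1, 2, 5, 8}"
    by (rule eqI[OF two_row_minors(6), where s = "1"]) (simp_all add: ev del: One_nat_def)
  have h126: "octad_vector p {1, 2, 6, 8} = plucker 4 8 octad_mat {1, 2, 6, 8}"
    by (rule eqI[OF two_row_minors(12), where s = "1"]) (simp_all add: ev del: One_nat_def)
  have h127: "octad_vector p {1, 2, 7, 8} = plucker 4 8 octad_mat {1, 2, 7, 8}"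
    by (rule eqI[OF two_row_minors(18), where s = "1"]) (simp_all add: ev del: One_nat_def)
  have h134: "octad_vector p {1, 3, 4, 8} = plucker 4 8 octad_mat {1, 3, 4, 8}"
    by (rule eqI[OF one_row_minors(2), where s = "1"]) (simp_all add: ev del: One_nat_def)
  have h135: "octad_vector p {1, 3, 5, 8} = plucker 4 8 octad_mat {1, 3, 5, 8}"
    by (rule eqI[OF two_row_minors(5), where s = "-1"]) (simp_all add: ev del: One_nat_def)
  have h136: "octad_vector p {1, 3, 6, 8} = plucker 4 8 octad_mat {1, 3, 6, 8}"
    by (rule eqI[OF two_row_minors(11), where s = "-1"]) (simp_all add: ev del: One_nat_def)
  have h137: "octad_vector p {1, 3, 7, 8} = plucker 4 8 octad_mat {1, 3, 7, 8}"
    by (rule eqI[OF two_row_minors(17), where s = "-1"]) (simp_all add: ev del: One_nat_def)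
  have h145: "octad_vector p {1, 4, 5, 8} = plucker 4 8 octad_mat {1, 4, 5, 8}"
    by (rule eqI[OF two_row_minors(4), where s = "1"]) (simp_all add: ev del: One_nat_def)
  have h146: "octad_vector p {1, 4, 6, 8} = plucker 4 8 octad_mat {1, 4, 6, 8}"
    by (rule eqI[OF two_row_minors(10), where s = "1"]) (simp_all add: ev del: One_nat_def)
  have h147: "octad_vector p {1, 4, 7, 8} = plucker 4 8 octad_mat {1, 4, 7, 8}"
    by (rule eqI[OF two_row_minors(16), where s = "1"]) (simp_all add: ev del: One_nat_def)
  have h156: "octad_vector p {1, 5, 6, 8} = plucker 4 8 octad_mat {1, 5, 6, 8}"
    by (rule eqI[OF three_row_minors(4), where s = "1"]) (simp_all add: ev del: One_nat_def)
  have h157: "octad_vector p {1, 5, 7, 8} = plucker 4 8 octad_mat {1, 5, 7, 8}"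
    by (rule eqI[OF three_row_minors(8), where s = "1"]) (simp_all add: ev del: One_nat_def)
  have h167: "octad_vector p {1, 6, 7, 8} = plucker 4 8 octad_mat {1, 6, 7, 8}"
    by (rule eqI[OF three_row_minors(12), where s = "1"]) (simp_all add: ev del: One_nat_def)
  have h234: "octad_vector p {2, 3, 4, 8} = plucker 4 8 octad_mat {2, 3, 4, 8}"
    by (rule eqI[OF one_row_minors(1), where s = "-1"]) (simp_all add: ev del: One_nat_def)
  have h235: "octad_vector p {2, 3, 5, 8} = plucker 4 8 octad_mat {2, 3, 5, 8}"
    by (rule eqI[OF two_row_minors(3), where s = "1"]) (simp_all add: ev del: One_nat_def)
  have h236: "octad_vector p {2, 3, 6, 8} = plucker 4 8 octad_mat {2, 3, 6, 8}"
    by (rule eqI[OF two_row_minors(9), where s = "1"]) (simp_all add: ev del: One_nat_def)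
  have h237: "octad_vector p {2, 3, 7, 8} = plucker 4 8 octad_mat {2, 3, 7, 8}"
    by (rule eqI[OF two_row_minors(15), where s = "1"]) (simp_all add: ev del: One_nat_def)
  have h245: "octad_vector p {2, 4, 5, 8} = plucker 4 8 octad_mat {2, 4, 5, 8}"
    by (rule eqI[OF two_row_minors(2), where s = "-1"]) (simp_all add: ev del: One_nat_def)
  have h246: "octad_vector p {2, 4, 6, 8} = plucker 4 8 octad_mat {2, 4, 6, 8}"
    by (rule eqI[OF two_row_minors(8), where s = "-1"]) (simp_all add: ev del: One_nat_def)
  have h247: "octad_vector p {2, 4, 7, 8} = plucker 4 8 octad_mat {2, 4, 7, 8}"
    by (rule eqI[OF two_row_minors(14), where s = "-1"]) (simp_all add: ev del: One_nat_def)
  have h256: "octad_vector p {2, 5, 6, 8} = plucker 4 8 octad_mat {2, 5, 6, 8}"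
    by (rule eqI[OF three_row_minors(3), where s = "-1"]) (simp_all add: ev del: One_nat_def)
  have h257: "octad_vector p {2, 5, 7, 8} = plucker 4 8 octad_mat {2, 5, 7, 8}"
    by (rule eqI[OF three_row_minors(7), where s = "-1"]) (simp_all add: ev del: One_nat_def)
  have h267: "octad_vector p {2, 6, 7, 8} = plucker 4 8 octad_mat {2, 6, 7, 8}"
    by (rule eqI[OF three_row_minors(11), where s = "-1"]) (simp_all add: ev del: One_nat_def)
  have h345: "octad_vector p {3, 4, 5, 8} = plucker 4 8 octad_mat {3, 4, 5, 8}"
    by (rule eqI[OF two_row_minors(1), where s = "1"]) (simp_all add: ev del: One_nat_def)
  have h346: "octad_vector p {3, 4, 6, 8} = plucker 4 8 octad_mat {3, 4, 6, 8}"
    by (rule eqI[OF two_row_minors(7), where s = "1"]) (simp_all add: ev del: One_nat_def)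
  have h347: "octad_vector p {3, 4, 7, 8} = plucker 4 8 octad_mat {3, 4, 7, 8}"
    by (rule eqI[OF two_row_minors(13), where s = "1"]) (simp_all add: ev del: One_nat_def)
  have h356: "octad_vector p {3, 5, 6, 8} = plucker 4 8 octad_mat {3, 5, 6, 8}"
    by (rule eqI[OF three_row_minors(2), where s = "1"]) (simp_all add: ev del: One_nat_def)
  have h357: "octad_vector p {3, 5, 7, 8} = plucker 4 8 octad_mat {3, 5, 7, 8}"
    by (rule eqI[OF three_row_minors(6), where s = "1"]) (simp_all add: ev del: One_nat_def)
  have h367: "octad_vector p {3, 6, 7, 8} = plucker 4 8 octad_mat {3, 6, 7, 8}"
    by (rule eqI[OF three_row_minors(10), where s = "1"]) (simp_all add: ev del: One_nat_def)
  have h456: "octad_vector p {4, 5, 6, 8} = plucker 4 8 octad_mat {4, 5, 6, 8}"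
    by (rule eqI[OF three_row_minors(1), where s = "-1"]) (simp_all add: ev del: One_nat_def)
  have h457: "octad_vector p {4, 5, 7, 8} = plucker 4 8 octad_mat {4, 5, 7, 8}"
    by (rule eqI[OF three_row_minors(5), where s = "-1"]) (simp_all add: ev del: One_nat_def)
  have h467: "octad_vector p {4, 6, 7, 8} = plucker 4 8 octad_mat {4, 6, 7, 8}"
    by (rule eqI[OF three_row_minors(9), where s = "-1"]) (simp_all add: ev del: One_nat_def)
  have h567: "octad_vector p {5, 6, 7, 8} = plucker 4 8 octad_mat {5, 6, 7, 8}"
    by (rule eqI[OF full_minor, where s = "1"]) (simp_all add: ev del: One_nat_def)
  have "i \<in> {1..5}" "j \<in> {2..6}" "k \<in> {3..7}"
    using ijk by auto
  moreover have "{1..5} = {1, 2, 3, 4, 5::nat}" "{2..6} = {2, 3, 4, 5, 6::nat}"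
    "{3..7} = {3, 4, 5, 6, 7::nat}" by auto
  ultimately have "i \<in> {1, 2, 3, 4, 5}" "j \<in> {2, 3, 4, 5, 6}" "k \<in> {3, 4, 5, 6, 7}"
    by (simp_all only:)
  moreover have "\<forall>i\<in>{1, 2, 3, 4, 5}. \<forall>j\<in>{2, 3, 4, 5, 6}. \<forall>k\<in>{3, 4, 5, 6, 7}. i < j \<longrightarrow> j < k \<longrightarrow>
      octad_vector p {i, j, k, 8} = plucker 4 8 octad_mat {i, j, k, 8}"
    by (simp add: h123 h124 h125 h126 h127 h134 h135 h136 h137 h145 h146 h147 h156 h157 h167 h234 h235 h236 h237 h245 h246 h247 h256 h257 h267 h345 h346 h347 h356 h357 h367 h456 h457 h467 h567 del: One_nat_def)
  ultimately show ?thesis using ijk(2,3) by blast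
qed

lemma octad_vector_plucker: "octad_vector p = plucker 4 8 octad_mat"
proof
  fix J :: "nat set"
  show "octad_vector p J = plucker 4 8 octad_mat J"
  proof (cases "J \<subseteq> {1..8} \<and> card J = 4")
    case True
    then obtain i j k l where J: "0 < i" "i < j" "j < k" "k < l" "l \<le> 8" "J = {i, j, k, l}"
      using four_subsetE[of J 8] by metis
    show ?thesis
    proof (cases "l = 8")
      case True
      then show ?thesis using J octad_vector_eighth by simp
    next
      case False
      then have "l \<le> 7" "8 \<notin> J" using J by auto
      then have "octad_vector p J = p J" using True by (simp add: octad_vector_def)
      moreover have "length W = 7" by (simp add: W_def)
      then have "(W @ [u]) ! (n - 1) = W ! (n - 1)" if "0 < n" "n \<le> 7" for n u
        using that by (cases n) (auto simp: nth_append)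
      ultimately show ?thesis
        using J \<open>l \<le> 7\<close> by (simp add: p_def octad_mat_def plucker_cols_mat)
    qed
  next
    case False
    then show ?thesis by (auto simp: octad_vector_def plucker_def)
  qed
qed

text \<open>This is the entry $*$ of $C^T X C$. Multiplied by \<open>x 5 * x 6 * x 7\<close> it
  becomes minus the expansion of $det(C)$ along the last column, and \<open>full_minor\<close> shows
  that $det(C)$ is nonzero.\<close>

lemma v_square_sum_nonzero:
  "v 1 * v 1 * x 1 + v 2 * v 2 * x 2 + v 3 * v 3 * x 3 + v 4 * v 4 * x 4 \<noteq> 0"
proof
  let ?m = "\<lambda>r. p {r, 5, 6, 7}"
  let ?s = "v 1 * v 1 * x 1 + v 2 * v 2 * x 2 + v 3 * v 3 * x 3 + v 4 * v 4 * x 4"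
  assume "?s = 0"
  moreover have "?s * (x 5 * x 6 * x 7) = v 1 * ?m 1 + v 2 * ?m 2 + v 3 * ?m 3 + v 4 * ?m 4"
    unfolding one_row_minors[symmetric] by (simp add: algebra_simps)
  ultimately have "v 1 * ?m 1 + v 2 * ?m 2 + v 3 * ?m 3 + v 4 * ?m 4 = 0" by simp
  moreover have "(1 * (a * (e * v 4 - f * v 3) - b * (d * v 4 - f * v 2) + c * (d * v 3 - e * v 2)) - 1 * (1 * (e * v 4 - f * v 3) - b * (1 * v 4 - f * v 1) + c * (1 * v 3 - e * v 1)) + 1 * (1 * (d * v 4 - f * v 2) - a * (1 * v 4 - f * v 1) + c * (1 * v 2 - d * v 1)) - 1 * (1 * (d * v 3 - e * v 2) - a * (1 * v 3 - e * v 1) + b * (1 * v 2 - d * v 1)))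
      = - (v 1 * ?m 1 + v 2 * ?m 2 + v 3 * ?m 3 + v 4 * ?m 4)"
    unfolding p_eqs by (simp add: algebra_simps)
  ultimately have "p {1, 2, 3, 4} = 0" by (simp only: full_minor[symmetric] minus_zero mult_zero_left)
  then show False by (simp only: p_eqs zero_neq_one[symmetric])
qed

text \<open>
  The off-diagonal entries of $C Y^{-1} C^T = - X^{-1}$, where $X$ and $Y$ are diagonal with
  $C^T X C = - Y$.
\<close>

lemma rank_one:
  obtains \<mu> where "\<mu> \<noteq> 0"
    "1 / x 5 + a / x 6 + d / x 7 = \<mu> * (v 1 * v 2)"
    "1 / x 5 + b / x 6 + e / x 7 = \<mu> * (v 1 * v 3)"
    "1 / x 5 + c / x 6 + f / x 7 = \<mu> * (v 1 * v 4)"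
    "1 / x 5 + a * b / x 6 + d * e / x 7 = \<mu> * (v 2 * v 3)"
    "1 / x 5 + a * c / x 6 + d * f / x 7 = \<mu> * (v 2 * v 4)"
    "1 / x 5 + b * c / x 6 + e * f / x 7 = \<mu> * (v 3 * v 4)"
proof -
  define z where "z = - (v 1 * v 1 * x 1 + v 2 * v 2 * x 2 + v 3 * v 3 * x 3 + v 4 * v 4 * x 4)"
  have z: "z \<noteq> 0" unfolding z_def neg_equal_0_iff_equal by (rule v_square_sum_nonzero)
  define C where "C = (\<lambda>r k. [[1, 1, 1, 1], [1, a, b, c], [1, d, e, f], [v 1, v 2, v 3, v 4]] ! k ! r)"
  define Y where "Y = (!) [x 5, x 6, x 7, z]"
  have xv: "v r * x r = p {r, 5, 6, 7} / (x 5 * x 6 * x 7)" if "r \<in> {1..7}" for r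
    using x_nz[OF that] by (simp add: v_def)
  have orth: "g 1 * v 1 * x 1 + g 2 * v 2 * x 2 + g 3 * v 3 * x 3 + g 4 * v 4 * x 4 =
      (g 1 * p {1, 5, 6, 7} + g 2 * p {2, 5, 6, 7} + g 3 * p {3, 5, 6, 7} + g 4 * p {4, 5, 6, 7})
        / (x 5 * x 6 * x 7)" for g :: "nat \<Rightarrow> 'a"
    using xv[of 1] xv[of 2] xv[of 3] xv[of 4]
    by (simp only: mult.assoc) (simp add: add_divide_distrib del: One_nat_def)
  have orth_v:
    "v 1 * x 1 + v 2 * x 2 + v 3 * x 3 + v 4 * x 4 = 0"
    "v 1 * x 1 + a * v 2 * x 2 + b * v 3 * x 3 + c * v 4 * x 4 = 0"
    "v 1 * x 1 + d * v 2 * x 2 + e * v 3 * x 3 + f * v 4 * x 4 = 0"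
    using orth[of "(!) [0, 1, 1, 1, 1]"] orth[of "(!) [0, 1, a, b, c]"] orth[of "(!) [0, 1, d, e, f]"]
    unfolding p_eqs by (simp_all add: algebra_simps del: One_nat_def)
  define S where "S = (\<lambda>k l. \<Sum>r<4. C r k * C r l * x (Suc r))"
  have comm: "S k l = S l k" for k l by (simp add: S_def mult.commute)
  have diag: "S 0 0 = - Y 0" "S 1 1 = - Y 1" "S 2 2 = - Y 2" "S 3 3 = - Y 3"
    by (simp_all add: S_def sum_lessThan_four C_def Y_def z_def x_eqs(5-7) flip: numeral_2_eq_2)
  have off: "S 0 1 = 0" "S 0 2 = 0" "S 1 2 = 0" "S 0 3 = 0" "S 1 3 = 0" "S 2 3 = 0"
    using x_orthogonal orth_v by (simp_all add: S_def sum_lessThan_four C_def flip: numeral_2_eq_2)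
  then have off': "S 1 0 = 0" "S 2 0 = 0" "S 2 1 = 0" "S 3 0 = 0" "S 3 1 = 0" "S 3 2 = 0"
    by (metis comm)+
  have "(\<Sum>r<4. C r k * C r l * x (Suc r)) = (if k = l then - Y k else 0)" if "k < 4" "l < 4" for k l
  proof -
    have "k \<in> {0, 1, 2, 3}" "l \<in> {0, 1, 2, 3}" using that by auto
    then have "S k l = (if k = l then - Y k else 0)"
      using diag off off' by (elim insertE emptyE) simp_all
    then show ?thesis by (simp only: S_def)
  qed
  moreover have "Y k \<noteq> 0" if "k < 4" for k
  proof -
    have "k \<in> {0, 1, 2, 3}" using that by auto
    then show ?thesis by (elim insertE emptyE) (simp_all add: Y_def x_nz z)
  qed
  moreover have "x (Suc r) \<noteq> 0" if "r < 4" for r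
    using that by (intro x_nz) auto
  ultimately have inv: "(\<Sum>k<4. C r k * C s k / Y k) = 0" if "r < 4" "s < 4" "r \<noteq> s" for r s
    using diagonal_congruence_inverse[of 4 C "\<lambda>r. x (Suc r)" Y r s] that by blast
  show ?thesis
  \<comment> \<open>Column 8 contributes \<open>v r * v s / z\<close> to the vanishing sum; moving
    it to the other side gives this factor.\<close>
  proof (rule that[of "- 1 / z"])
    show "- 1 / z \<noteq> 0" using z by simp
  qed (use inv[of 0 1] inv[of 0 2] inv[of 0 3] inv[of 1 2] inv[of 1 3] inv[of 2 3] in
      \<open>simp_all add: sum_lessThan_four C_def Y_def add_eq_0_iff2\<close>)
qed

end

subsection \<open>Quadrics in projective 3-space\<close>

lemma quad_form_expand:
  "quad_form q z =
     q 0 0 * z $ 0 * z $ 0 + q 0 1 * z $ 0 * z $ 1 + q 0 2 * z $ 0 * z $ 2 + q 0 3 * z $ 0 * z $ 3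
   + q 1 1 * z $ 1 * z $ 1 + q 1 2 * z $ 1 * z $ 2 + q 1 3 * z $ 1 * z $ 3
   + q 2 2 * z $ 2 * z $ 2 + q 2 3 * z $ 2 * z $ 3 + q 3 3 * z $ 3 * z $ 3"
proof -
  have "{0..<4} = {0, 1, 2, 3::nat}" "{1..<4} = {1, 2, 3::nat}" "{2..<4} = {2, 3::nat}" "{3..<4} = {3::nat}"
    by auto
  then show ?thesis
    unfolding quad_form_def sum_lessThan_four by (simp add: algebra_simps)
qed

lemma quad_form_linear:
  "quad_form (\<lambda>i j. r * q i j + s * q' i j + t * q'' i j) z =
    r * quad_form q z + s * quad_form q' z + t * quad_form q'' z"
  by (simp add: quad_form_expand algebra_simps)

lemma quad_form_smult:
  assumes "z \<in> carrier_vec 4"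
  shows "quad_form q (s \<cdot>\<^sub>v z) = s * s * quad_form q z"
  using assms by (simp add: quad_form_expand algebra_simps)

text \<open>Evaluation at the unit vectors and at sums of two of them isolates every coefficient
  without dividing, so small fields and characteristic 2 cause no trouble.\<close>

lemma quad_form_zero_coeffs:
  fixes q :: "nat \<Rightarrow> nat \<Rightarrow> 'a::field"
  assumes zero: "\<And>z. z \<in> carrier_vec 4 \<Longrightarrow> quad_form q z = 0" and ij: "i \<le> j" "j < 4"
  shows "q i j = 0"
proof -
  have vec: "quad_form q (vec 4 ((!) [z0, z1, z2, z3])) = 0" for z0 z1 z2 z3
    by (rule zero) simp
  have nth: "vec 4 ((!) [z0, z1, z2, z3]) $ 0 = z0" "vec 4 ((!) [z0, z1, z2, z3]) $ 1 = z1"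
    "vec 4 ((!) [z0, z1, z2, z3]) $ 2 = z2" "vec 4 ((!) [z0, z1, z2, z3]) $ 3 = z3" for z0 z1 z2 z3 :: 'a
    by simp_all
  note ev = vec[unfolded quad_form_expand nth]
  have diag: "q 0 0 = 0" "q 1 1 = 0" "q 2 2 = 0" "q 3 3 = 0"
    using ev[of 1 0 0 0] ev[of 0 1 0 0] ev[of 0 0 1 0] ev[of 0 0 0 1] by simp_all
  have "q 0 1 = 0" "q 0 2 = 0" "q 0 3 = 0" "q 1 2 = 0" "q 1 3 = 0" "q 2 3 = 0"
    using ev[of 1 1 0 0] ev[of 1 0 1 0] ev[of 1 0 0 1] ev[of 0 1 1 0] ev[of 0 1 0 1] ev[of 0 0 1 1]
    by (simp_all add: diag[simplified])
  moreover have "j = 0 \<or> j = 1 \<or> j = 2 \<or> j = 3" "i = 0 \<or> i = 1 \<or> i = 2 \<or> i = 3"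
    using ij by auto
  ultimately show ?thesis using ij diag by (elim disjE) simp_all
qed

lemma quad_form_pullback:
  fixes q :: "nat \<Rightarrow> nat \<Rightarrow> 'a::field"
  assumes h: "h \<in> carrier_mat 4 4"
  obtains q' where "\<And>z. z \<in> carrier_vec 4 \<Longrightarrow> quad_form q (h *\<^sub>v z) = quad_form q' z"
proof -
  \<comment> \<open>Forms are stored by their coefficients with \<open>i \<le> j\<close>: a mixed
    monomial collects both orders of a product of linear forms, a square only one.\<close>
  define q' where "q' = (\<lambda>k l. \<Sum>i<4. \<Sum>j\<in>{i..<4}. q i j *
    (if k = l then h $$ (i, k) * h $$ (j, k) else h $$ (i, k) * h $$ (j, l) + h $$ (i, l) * h $$ (j, k)))"
  have "quad_form q (h *\<^sub>v z) = quad_form q' z" if z: "z \<in> carrier_vec 4" for z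
  proof -
    have hz: "(h *\<^sub>v z) $ i = (\<Sum>k<4. h $$ (i, k) * z $ k)" if "i < 4" for i
      using that h z by (simp add: scalar_prod_def atLeast0LessThan)
    have prod: "quad_form (\<lambda>k l. if k = l then u k * w k else u k * w l + u l * w k) z =
        (\<Sum>k<4. u k * z $ k) * (\<Sum>k<4. w k * z $ k)" for u w :: "nat \<Rightarrow> 'a"
      unfolding quad_form_expand sum_lessThan_four by (simp add: algebra_simps)
    have "quad_form q (h *\<^sub>v z) =
        (\<Sum>i<4. \<Sum>j\<in>{i..<4}. q i j * quad_form (\<lambda>k l. if k = l then h $$ (i, k) * h $$ (j, k)
          else h $$ (i, k) * h $$ (j, l) + h $$ (i, l) * h $$ (j, k)) z)"
      unfolding quad_form_def[of q] prod by (intro sum.cong refl) (simp add: hz)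
    also have "\<dots> = quad_form q' z"
      unfolding q'_def quad_form_expand
      by (simp only: sum_distrib_right sum_distrib_left sum.distrib distrib_left mult.assoc)
    finally show ?thesis .
  qed
  then show ?thesis using that by blast
qed

section \<open>Linear algebra for points given by products of coordinates and for nets of
  quadrics\<close>

text \<open>The squares are not given, so the ratio of two coordinates is read off from their
  products with a third one, which is nonzero.\<close>

lemma proportional_of_products:
  fixes k :: "'a::field"
  assumes "k \<noteq> 0" "w1 \<noteq> 0" "w2 \<noteq> 0" "w3 \<noteq> 0" "w4 \<noteq> 0"
    and "z1 * z2 = k * (w1 * w2)" "z1 * z3 = k * (w1 * w3)" "z1 * z4 = k * (w1 * w4)"
    and "z2 * z3 = k * (w2 * w3)" "z2 * z4 = k * (w2 * w4)" "z3 * z4 = k * (w3 * w4)"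
  shows "\<exists>c. z1 = c * w1 \<and> z2 = c * w2 \<and> z3 = c * w3 \<and> z4 = c * w4"
proof -
  have nz: "z1 \<noteq> 0" "z2 \<noteq> 0" "z3 \<noteq> 0" "z4 \<noteq> 0" using assms by auto
  have ratio: "y * w1 = z1 * w" if "z1 * u = k * (w1 * s)" "y * u = k * (w * s)" "u \<noteq> 0" for y w u s
  proof -
    have "(y * w1) * u = (z1 * w) * u"
      using that(1,2) by (metis (no_types, lifting) mult.assoc mult.commute mult.left_commute)
    then show ?thesis using that(3) by simp
  qed
  have "z2 * w1 = z1 * w2" using ratio[of z3 w3 z2 w2] assms nz by blast
  moreover have "z3 * w1 = z1 * w3" using ratio[of z2 w2 z3 w3] assms nz by (simp add: mult.commute)
  moreover have "z4 * w1 = z1 * w4" using ratio[of z2 w2 z4 w4] assms nz by (simp add: mult.commute)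
  ultimately show ?thesis
    using assms(2) by (intro exI[of _ "z1 / w1"]) (simp add: field_simps)
qed

text \<open>A square matrix and its transpose are singular together. This turns the independence of
  three combinations of three quadrics into the vanishing of the quadrics themselves.\<close>

lemma left_kernel_trivial_imp_right:
  fixes M :: "nat \<Rightarrow> nat \<Rightarrow> 'a::field"
  assumes left: "\<And>r. (\<And>j. j < n \<Longrightarrow> (\<Sum>i<n. r i * M i j) = 0) \<Longrightarrow> \<forall>i<n. r i = 0"
    and right: "\<And>i. i < n \<Longrightarrow> (\<Sum>j<n. M i j * q j) = 0" and "j < n"
  shows "q j = 0"
proof (rule ccontr)
  assume nz: "q j \<noteq> 0"
  define A where "A = mat n n (\<lambda>(i, j). M i j)"
  have A: "A \<in> carrier_mat n n" by (simp add: A_def)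
  have "A *\<^sub>v vec n q = 0\<^sub>v n"
    using right by (intro eq_vecI) (simp_all add: A_def scalar_prod_def atLeast0LessThan)
  moreover have "vec n q \<noteq> 0\<^sub>v n"
  proof
    assume "vec n q = 0\<^sub>v n"
    then have "vec n q $ j = 0\<^sub>v n $ j" by simp
    with nz \<open>j < n\<close> show False by simp
  qed
  ultimately have "det A = 0"
    using det_0_iff_vec_prod_zero_field[OF A] vec_carrier[of n q] by blast
  then have "det A\<^sup>T = 0" using det_transpose[OF A] by simp
  then obtain r where r: "r \<in> carrier_vec n" "r \<noteq> 0\<^sub>v n" "A\<^sup>T *\<^sub>v r = 0\<^sub>v n"
    using det_0_iff_vec_prod_zero_field[of "A\<^sup>T" n] A by auto
  have "(\<Sum>i<n. r $ i * M i j) = 0" if "j < n" for j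
  proof -
    have "(A\<^sup>T *\<^sub>v r) $ j = (\<Sum>i<n. M i j * r $ i)"
      using that r(1) by (simp add: A_def scalar_prod_def atLeast0LessThan)
    then show ?thesis using r(3) that by (simp add: mult.commute)
  qed
  then have "\<forall>i<n. r $ i = 0" using left[of "\<lambda>i. r $ i"] by blast
  then have "r = 0\<^sub>v n" using r(1) by (intro eq_vecI) auto
  with r(2) show False ..
qed

lemma col_cols_mat:
  assumes "j < m"
  shows "col (cols_mat m L) j = vec 4 ((!) (L ! j))"
  using assms by (intro eq_vecI) (auto simp: cols_mat_def)

lemma vec4_proportional:
  fixes z :: "'a::field vec"
  assumes "z \<in> carrier_vec 4"
  shows "z = s \<cdot>\<^sub>v vec 4 ((!) [w0, w1, w2, w3]) \<longleftrightarrow>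
    z $ 0 = s * w0 \<and> z $ 1 = s * w1 \<and> z $ 2 = s * w2 \<and> z $ 3 = s * w3"
proof
  assume "z = s \<cdot>\<^sub>v vec 4 ((!) [w0, w1, w2, w3])"
  then show "z $ 0 = s * w0 \<and> z $ 1 = s * w1 \<and> z $ 2 = s * w2 \<and> z $ 3 = s * w3"
    by simp
next
  assume eq: "z $ 0 = s * w0 \<and> z $ 1 = s * w1 \<and> z $ 2 = s * w2 \<and> z $ 3 = s * w3"
  show "z = s \<cdot>\<^sub>v vec 4 ((!) [w0, w1, w2, w3])"
  proof (rule eq_vecI)
    fix i assume "i < dim_vec (s \<cdot>\<^sub>v vec 4 ((!) [w0, w1, w2, w3]))"
    then have "i = 0 \<or> i = 1 \<or> i = 2 \<or> i = 3" by auto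
    then show "z $ i = (s \<cdot>\<^sub>v vec 4 ((!) [w0, w1, w2, w3])) $ i"
      using eq by (elim disjE) simp_all
  qed (use assms in simp)
qed

text \<open>Two proportional columns make every minor containing both vanish; a four-set containing
  both indices exists.\<close>

lemma columns_not_proportional:
  fixes A :: "'a::field mat"
  assumes A: "A \<in> carrier_mat 4 8" and nz: "all_nonzero 4 8 (plucker 4 8 A)"
    and jk: "j < 8" "k < 8" "j \<noteq> k"
  shows "col A k \<noteq> s \<cdot>\<^sub>v col A j"
proof
  assume eq: "col A k = s \<cdot>\<^sub>v col A j"
  have scal: "A $$ (r, k) = s * A $$ (r, j)" if "r < 4" for r
  proof -
    have "col A k $ r = (s \<cdot>\<^sub>v col A j) $ r" by (simp only: eq)
    then show ?thesis using that jk A by simp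
  qed
  have "card ({1..8} - {Suc j, Suc k}) = 6" using jk by (subst card_Diff_subset) auto
  then obtain T where T: "T \<subseteq> {1..8} - {Suc j, Suc k}" "card T = 2"
    using obtain_subset_with_card_n[of 2 "{1..8} - {Suc j, Suc k}"] by auto
  define I where "I = {Suc j, Suc k} \<union> T"
  have finT: "finite T" using T(1) finite_subset by blast
  have "card I = 4"
    unfolding I_def using T jk finT by (subst card_Un_disjoint) auto
  moreover have "I \<subseteq> {1..8}" using T jk by (auto simp: I_def)
  ultimately obtain i1 i2 i3 i4 where i: "0 < i1" "i1 < i2" "i2 < i3" "i3 < i4" "i4 \<le> 8"
    and I: "I = {i1, i2, i3, i4}"
    using four_subsetE by metis
  have "plucker 4 8 A I \<noteq> 0"
    using nz \<open>card I = 4\<close> \<open>I \<subseteq> {1..8}\<close> by (auto simp: all_nonzero_def)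
  moreover have "plucker 4 8 A I = 0"
  proof -
    have "Suc j \<in> {i1, i2, i3, i4}" "Suc k \<in> {i1, i2, i3, i4}" unfolding I[symmetric] I_def by auto
    moreover have "Suc j = n \<Longrightarrow> j = n - 1" "Suc k = n \<Longrightarrow> k = n - 1" for n by auto
    ultimately have "j \<in> {i1 - 1, i2 - 1, i3 - 1, i4 - 1}" "k \<in> {i1 - 1, i2 - 1, i3 - 1, i4 - 1}"
      by blast+
    with jk(3) show ?thesis
      unfolding I plucker_four[OF i] det4_def
      by (elim insertE emptyE) (use scal in \<open>simp_all add: algebra_simps\<close>)
  qed
  ultimately show False by simp
qed

subsection \<open>The octad as an intersection of quadrics\<close>

lemma ex_less_eight:
  "(\<exists>j<8::nat. P j) \<longleftrightarrow> P 0 \<or> P 1 \<or> P 2 \<or> P 3 \<or> P 4 \<or> P 5 \<or> P 6 \<or> P 7"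
proof -
  have "{..<8} = {0, 1, 2, 3, 4, 5, 6, 7::nat}" by auto
  then have "(\<exists>j\<in>{..<8}. P j) \<longleftrightarrow> (\<exists>j\<in>{0, 1, 2, 3, 4, 5, 6, 7}. P j)" by (simp only:)
  then show ?thesis by (auto simp del: One_nat_def)
qed

lemma eliminate_linear:
  fixes P :: "'a::comm_ring_1"
  assumes eq: "P * w1 + Q * w2 + R * w3 = 0" and eq': "P' * w1 + Q' * w2 + R' * w3 = 0"
  shows "(P * Q' - Q * P') * w1 = (Q * R' - R * Q') * w3"
    and "(P * Q' - Q * P') * w2 = - ((P * R' - R * P') * w3)"
proof -
  have "(P * Q' - Q * P') * w1 - (Q * R' - R * Q') * w3
      = Q' * (P * w1 + Q * w2 + R * w3) - Q * (P' * w1 + Q' * w2 + R' * w3)"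
    and "(P * Q' - Q * P') * w2 - - ((P * R' - R * P') * w3)
      = P * (P' * w1 + Q' * w2 + R' * w3) - P' * (P * w1 + Q * w2 + R * w3)"
    by (simp_all add: algebra_simps)
  then show "(P * Q' - Q * P') * w1 = (Q * R' - R * Q') * w3"
    and "(P * Q' - Q * P') * w2 = - ((P * R' - R * P') * w3)"
    unfolding eq eq' by (simp_all only: mult_zero_right diff_self right_minus_eq)
qed

context normal_form
begin

abbreviation (input) \<Delta> :: 'a where
  "\<Delta> \<equiv> (b * f - c * e) - (a * f - c * d) + (a * e - b * d)"

text \<open>
  The vector of products \<open>z\<^sub>i z\<^sub>j\<close>, \<open>i < j\<close>, lies in the span of those of the points 5, 6 and 7,
  that is, every quadric through the seven points vanishes at \<open>z\<close>.
\<close>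

definition span_condition :: "'a \<Rightarrow> 'a \<Rightarrow> 'a \<Rightarrow> 'a \<Rightarrow> 'a \<Rightarrow> 'a \<Rightarrow> 'a \<Rightarrow> bool" where
  "span_condition s t u z1 z2 z3 z4 \<longleftrightarrow>
     z1 * z2 = s + t * a + u * d \<and> z1 * z3 = s + t * b + u * e \<and> z1 * z4 = s + t * c + u * f \<and>
     z2 * z3 = s + t * (a * b) + u * (d * e) \<and> z2 * z4 = s + t * (a * c) + u * (d * f) \<and>
     z3 * z4 = s + t * (b * c) + u * (e * f)"

text \<open>
  Solving the first three equations of \<open>span_condition\<close> for \<open>s, t, u\<close> by Cramer's rule turns each of the
  other three into a quadric; \<open>A\<close> and \<open>B\<close> stand for the products of the coordinates \<open>m\<close> and \<open>n\<close> of the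
  points 6 and 7.
\<close>

definition quadric :: "'a \<Rightarrow> 'a \<Rightarrow> nat \<Rightarrow> nat \<Rightarrow> nat \<Rightarrow> nat \<Rightarrow> 'a" where
  "quadric A B m n i j =
     (if i = 0 \<and> j = 1 then - ((b * f - c * e) - (f - e) * A + (c - b) * B)
      else if i = 0 \<and> j = 2 then - (- (a * f - c * d) + (f - d) * A - (c - a) * B)
      else if i = 0 \<and> j = 3 then - ((a * e - b * d) - (e - d) * A + (b - a) * B)
      else if i = m \<and> j = n then \<Delta> else 0)"

abbreviation q23 :: "nat \<Rightarrow> nat \<Rightarrow> 'a" where "q23 \<equiv> quadric (a * b) (d * e) 1 2"
abbreviation q24 :: "nat \<Rightarrow> nat \<Rightarrow> 'a" where "q24 \<equiv> quadric (a * c) (d * f) 1 3"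
abbreviation q34 :: "nat \<Rightarrow> nat \<Rightarrow> 'a" where "q34 \<equiv> quadric (b * c) (e * f) 2 3"

text \<open>Each of the three quadrics has a mixed monomial of its own, with coefficient
  \<open>\<Delta>\<close>.\<close>

lemma quadric_independent:
  assumes "\<Delta> \<noteq> 0"
    and "\<forall>i<4. \<forall>j\<in>{i..<4}. r * q23 i j + s * q24 i j + t * q34 i j = 0"
  shows "r = 0 \<and> s = 0 \<and> t = 0"
proof -
  have "r * q23 i j + s * q24 i j + t * q34 i j = 0" if "i \<le> j" "j < 4" for i j
    using assms(2) that by auto
  from this[of 1 2] this[of 1 3] this[of 2 3] assms(1) show ?thesis
    by (simp add: quadric_def)
qed

lemma quadric_eq:
  "quad_form (quadric A B m n) z =
     \<Delta> * (z $ m * z $ n) - (((b * f - c * e) * (z $ 0 * z $ 1) - (a * f - c * d) * (z $ 0 * z $ 2) + (a * e - b * d) * (z $ 0 * z $ 3))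
       + (- (f - e) * (z $ 0 * z $ 1) + (f - d) * (z $ 0 * z $ 2) - (e - d) * (z $ 0 * z $ 3)) * A
       + ((c - b) * (z $ 0 * z $ 1) - (c - a) * (z $ 0 * z $ 2) + (b - a) * (z $ 0 * z $ 3)) * B)"
  if "(m, n) \<in> {(1, 2), (1, 3), (2, 3)}"
  using that by (elim insertE emptyE) (simp_all add: quad_form_expand quadric_def, simp_all add: algebra_simps)

lemma span_condition_imp_quadrics:
  assumes "span_condition s t u (z $ 0) (z $ 1) (z $ 2) (z $ 3)"
  shows "quad_form q23 z = 0" "quad_form q24 z = 0" "quad_form q34 z = 0"
  using assms by (simp_all add: quadric_eq span_condition_def, simp_all add: algebra_simps)

lemma quadrics_imp_span_condition:
  assumes D: "\<Delta> \<noteq> 0"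
    and q: "quad_form q23 z = 0" "quad_form q24 z = 0" "quad_form q34 z = 0"
  obtains s t u where "span_condition s t u (z $ 0) (z $ 1) (z $ 2) (z $ 3)"
proof -
  define y2 y3 y4 where "y2 = z $ 0 * z $ 1" and "y3 = z $ 0 * z $ 2" and "y4 = z $ 0 * z $ 3"
  define S where "S = (b * f - c * e) * y2 - (a * f - c * d) * y3 + (a * e - b * d) * y4"
  define T where "T = - (f - e) * y2 + (f - d) * y3 - (e - d) * y4"
  define U where "U = (c - b) * y2 - (c - a) * y3 + (b - a) * y4"
  define D where "D = \<Delta>"
  have D0: "D \<noteq> 0" using D by (simp add: D_def)
  have "S + T * a + U * d = D * y2" "S + T * b + U * e = D * y3" "S + T * c + U * f = D * y4"
    by (simp_all add: S_def T_def U_def D_def algebra_simps)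
  moreover have "S + T * (a * b) + U * (d * e) = D * (z $ 1 * z $ 2)"
    "S + T * (a * c) + U * (d * f) = D * (z $ 1 * z $ 3)"
    "S + T * (b * c) + U * (e * f) = D * (z $ 2 * z $ 3)"
    using q by (simp_all add: quadric_eq S_def T_def U_def D_def y2_def y3_def y4_def)
  moreover have "g = S / D + T / D * A + U / D * B" if "S + T * A + U * B = D * g" for g A B
  proof -
    have "S / D + T / D * A + U / D * B = (S + T * A + U * B) / D" by (simp add: add_divide_distrib)
    with that D0 show ?thesis by simp
  qed
  ultimately have "span_condition (S / D) (T / D) (U / D) (z $ 0) (z $ 1) (z $ 2) (z $ 3)"
    unfolding span_condition_def y2_def y3_def y4_def by simp
  then show ?thesis by (rule that)
qed

text \<open>\<open>q23\<close>, \<open>q24\<close>, \<open>q34\<close> span the quadrics through the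
  seven points: the points 1 to 4 kill the squares, and the points 5 to 7 determine the coefficients
  of the monomials containing the first coordinate from the other three.\<close>

lemma quad_form_through_points:
  assumes Q: "\<And>j. j < 7 \<Longrightarrow> quad_form Q (vec 4 ((!) (W ! j))) = 0"
  shows "\<Delta> * quad_form Q z = Q 1 2 * quad_form q23 z + Q 1 3 * quad_form q24 z + Q 2 3 * quad_form q34 z"
proof -
  have diag: "Q 0 0 = 0" "Q 1 1 = 0" "Q 2 2 = 0" "Q 3 3 = 0"
    using Q[of 0] Q[of 1] Q[of 2] Q[of 3] by (simp_all add: quad_form_expand W_def)
  define E5 where "E5 = Q 0 1 + Q 0 2 + Q 0 3 + Q 1 2 + Q 1 3 + Q 2 3"
  define E6 where "E6 = Q 0 1 * a + Q 0 2 * b + Q 0 3 * c + Q 1 2 * (a * b) + Q 1 3 * (a * c) + Q 2 3 * (b * c)"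
  define E7 where "E7 = Q 0 1 * d + Q 0 2 * e + Q 0 3 * f + Q 1 2 * (d * e) + Q 1 3 * (d * f) + Q 2 3 * (e * f)"
  have E: "E5 = 0" "E6 = 0" "E7 = 0"
    using Q[of 4] Q[of 5] Q[of 6] diag
    by (simp_all add: quad_form_expand W_def E5_def E6_def E7_def mult.assoc)
  \<comment> \<open>The multipliers of the three incidence conditions are the Cramer numerators for
    \<open>s\<close>, \<open>t\<close>, \<open>u\<close>.\<close>
  have "\<Delta> * quad_form Q z - (Q 1 2 * quad_form q23 z + Q 1 3 * quad_form q24 z + Q 2 3 * quad_form q34 z) =
      E5 * ((b * f - c * e) * (z $ 0 * z $ 1) - (a * f - c * d) * (z $ 0 * z $ 2) + (a * e - b * d) * (z $ 0 * z $ 3))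
    + E6 * (- (f - e) * (z $ 0 * z $ 1) + (f - d) * (z $ 0 * z $ 2) - (e - d) * (z $ 0 * z $ 3))
    + E7 * ((c - b) * (z $ 0 * z $ 1) - (c - a) * (z $ 0 * z $ 2) + (b - a) * (z $ 0 * z $ 3))"
    unfolding quad_form_expand[of Q] diag
    by (simp add: quadric_eq E5_def E6_def E7_def, simp add: algebra_simps)
  then show ?thesis by (simp add: E)
qed

end

section \<open>The common zeros of the three quadrics\<close>

context general_normal_form
begin

lemma p_four_nz:
  assumes "0 < i" "i < j" "j < k" "k < l" "l \<le> 7"
  shows "p {i, j, k, l} \<noteq> 0"
  using p_nz assms card_four[of i j k l] unfolding all_nonzero_def by auto

lemma params_nz: "a \<noteq> 0" "b \<noteq> 0" "c \<noteq> 0" "d \<noteq> 0" "e \<noteq> 0" "f \<noteq> 0"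
  using p_four_nz[of 1 3 4 6] p_four_nz[of 1 2 4 6] p_four_nz[of 1 2 3 6]
    p_four_nz[of 1 3 4 7] p_four_nz[of 1 2 4 7] p_four_nz[of 1 2 3 7]
  unfolding p_eqs by auto

lemma \<Delta>_nz: "\<Delta> \<noteq> 0"
  using p_four_nz[of 1 5 6 7] unfolding p_eqs by simp

lemma v_nz: "r \<in> {1..4} \<Longrightarrow> v r \<noteq> 0"
  using p_four_nz[of r 5 6 7] x_nz[of r] x_nz[of 5] x_nz[of 6] x_nz[of 7] by (auto simp: v_def)

lemma span_condition_imp_point:
  assumes "span_condition s t u z1 z2 z3 z4"
  shows "\<exists>w\<in>set (W @ [[v 1, v 2, v 3, v 4]]). \<exists>k.
    z1 = k * w ! 0 \<and> z2 = k * w ! 1 \<and> z3 = k * w ! 2 \<and> z4 = k * w ! 3"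
proof -
  note z = assms[unfolded span_condition_def]
  let ?P = "(1 - c) * (a - b)" and ?Q = "(1 - f) * (d - e)" and ?R = "(f - c) * (a * e - b * d)"
  let ?P' = "(1 - b) * (a - c)" and ?Q' = "(1 - e) * (d - f)" and ?R' = "(e - b) * (a * f - c * d)"
  have "(z1 * z2) * (z3 * z4) - (z1 * z3) * (z2 * z4) = 0" "(z1 * z2) * (z3 * z4) - (z1 * z4) * (z2 * z3) = 0"
    by (simp_all add: mult_ac)
  then have "(s + t * a + u * d) * (s + t * (b * c) + u * (e * f))
        - (s + t * b + u * e) * (s + t * (a * c) + u * (d * f)) = 0"
    "(s + t * a + u * d) * (s + t * (b * c) + u * (e * f))
        - (s + t * c + u * f) * (s + t * (a * b) + u * (d * e)) = 0"
    using z by simp_all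
  then have eq: "?P * (s * t) + ?Q * (s * u) + ?R * (t * u) = 0"
    and eq': "?P' * (s * t) + ?Q' * (s * u) + ?R' * (t * u) = 0"
    by (simp_all add: algebra_simps)
  have st: "x 5 * (s * t) = x 7 * (t * u)" and su: "x 5 * (s * u) = x 6 * (t * u)"
    using eliminate_linear[OF eq eq', unfolded cross_product_relations]
    by (simp_all only: mult_minus_left neg_equal_iff_equal)
  have x5: "x 5 \<noteq> 0" and x6: "x 6 \<noteq> 0" and x7: "x 7 \<noteq> 0" by (simp_all add: x_nz)
  \<comment> \<open>As \<open>x 5\<close>, \<open>x 6\<close>, \<open>x 7\<close> are nonzero,
    \<open>st\<close> and \<open>su\<close> make the three products vanish together; so if one of
    \<open>s, t, u\<close> is zero, at least two are.\<close>
  have "s * t = 0 \<and> s * u = 0 \<and> t * u = 0" if "s = 0 \<or> t = 0 \<or> u = 0"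
    using that st su x5 x6 x7 by auto
  then consider "s \<noteq> 0" "t \<noteq> 0" "u \<noteq> 0" | "s \<noteq> 0" "t = 0" "u = 0" | "s = 0" "t \<noteq> 0" "u = 0"
    | "s = 0" "t = 0" "u \<noteq> 0" | "s = 0" "t = 0" "u = 0"
    by (cases "s = 0"; cases "t = 0"; cases "u = 0") auto
  then show ?thesis
  proof cases
    case 1
    define k where "k = x 5 * s"
    have "x 5 * s = x 7 * u" "x 5 * s = x 6 * t"
      using st su 1 by (simp_all add: mult.assoc[symmetric])
    then have stu: "s = k / x 5" "t = k / x 6" "u = k / x 7"
      using x5 x6 x7 by (simp_all add: k_def field_simps)
    have "k \<noteq> 0" using 1 x5 by (simp add: k_def)
    obtain \<mu> where \<mu>: "\<mu> \<noteq> 0"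
      "1 / x 5 + a / x 6 + d / x 7 = \<mu> * (v 1 * v 2)"
      "1 / x 5 + b / x 6 + e / x 7 = \<mu> * (v 1 * v 3)"
      "1 / x 5 + c / x 6 + f / x 7 = \<mu> * (v 1 * v 4)"
      "1 / x 5 + a * b / x 6 + d * e / x 7 = \<mu> * (v 2 * v 3)"
      "1 / x 5 + a * c / x 6 + d * f / x 7 = \<mu> * (v 2 * v 4)"
      "1 / x 5 + b * c / x 6 + e * f / x 7 = \<mu> * (v 3 * v 4)"
      by (rule rank_one)
    have lin: "s + t * A + u * B = k * (1 / x 5 + A / x 6 + B / x 7)" for A B
      unfolding stu by (simp add: distrib_left)
    have "\<exists>c. z1 = c * v 1 \<and> z2 = c * v 2 \<and> z3 = c * v 3 \<and> z4 = c * v 4"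
    proof (rule proportional_of_products[of "k * \<mu>"])
      show "k * \<mu> \<noteq> 0" using \<open>k \<noteq> 0\<close> \<mu>(1) by simp
    qed (use z in \<open>simp_all add: v_nz lin \<mu> mult.assoc del: One_nat_def\<close>)
    then show ?thesis by simp
  next
    case 2
    have "\<exists>c. z1 = c * 1 \<and> z2 = c * 1 \<and> z3 = c * 1 \<and> z4 = c * 1"
      by (rule proportional_of_products[of s]) (use z 2 in simp_all)
    then show ?thesis by (simp add: W_def)
  next
    case 3
    have "\<exists>k. z1 = k * 1 \<and> z2 = k * a \<and> z3 = k * b \<and> z4 = k * c"
      by (rule proportional_of_products[of t]) (use z 3 params_nz in simp_all)
    then show ?thesis by (simp add: W_def)
  next
    case 4
    have "\<exists>k. z1 = k * 1 \<and> z2 = k * d \<and> z3 = k * e \<and> z4 = k * f"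
      by (rule proportional_of_products[of u]) (use z 4 params_nz in simp_all)
    then show ?thesis by (simp add: W_def)
  next
    case 5
    \<comment> \<open>All mixed products vanish, so at most one coordinate is nonzero: these are the
      coordinate points 1 to 4.\<close>
    with z have "z1 * z2 = 0" "z1 * z3 = 0" "z1 * z4 = 0" "z2 * z3 = 0" "z2 * z4 = 0" "z3 * z4 = 0"
      by simp_all
    then have "z2 = 0 \<and> z3 = 0 \<and> z4 = 0 \<or> z1 = 0 \<and> z3 = 0 \<and> z4 = 0 \<or>
        z1 = 0 \<and> z2 = 0 \<and> z4 = 0 \<or> z1 = 0 \<and> z2 = 0 \<and> z3 = 0"
      by auto
    then show ?thesis by (auto simp: W_def)
  qed
qed

lemma point_imp_span_condition:
  assumes "w \<in> set (W @ [[v 1, v 2, v 3, v 4]])"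
  obtains s t u where "span_condition s t u (k * w ! 0) (k * w ! 1) (k * w ! 2) (k * w ! 3)"
proof -
  obtain \<mu> where \<mu>: "\<mu> \<noteq> 0"
    "1 / x 5 + a / x 6 + d / x 7 = \<mu> * (v 1 * v 2)"
    "1 / x 5 + b / x 6 + e / x 7 = \<mu> * (v 1 * v 3)"
    "1 / x 5 + c / x 6 + f / x 7 = \<mu> * (v 1 * v 4)"
    "1 / x 5 + a * b / x 6 + d * e / x 7 = \<mu> * (v 2 * v 3)"
    "1 / x 5 + a * c / x 6 + d * f / x 7 = \<mu> * (v 2 * v 4)"
    "1 / x 5 + b * c / x 6 + e * f / x 7 = \<mu> * (v 3 * v 4)"
    by (rule rank_one)
  have lin: "k * k / \<mu> / x 5 + k * k / \<mu> / x 6 * A + k * k / \<mu> / x 7 * B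
      = k * k / \<mu> * (1 / x 5 + A / x 6 + B / x 7)" for A B
    by (simp add: distrib_left)
  \<comment> \<open>Scaling a point by \<open>k\<close> scales its products by \<open>k * k\<close>;
    dividing \<open>rank_one\<close> by \<open>\<mu>\<close> expresses the products of the eighth
    point.\<close>
  have "span_condition (k * k / \<mu> / x 5) (k * k / \<mu> / x 6) (k * k / \<mu> / x 7) (k * v 1) (k * v 2) (k * v 3) (k * v 4)"
    unfolding span_condition_def lin \<mu>(2-7) using \<mu>(1) by (simp add: mult_ac)
  moreover have "span_condition (k * k) 0 0 (k * 1) (k * 1) (k * 1) (k * 1)"
    "span_condition 0 (k * k) 0 (k * 1) (k * a) (k * b) (k * c)"
    "span_condition 0 0 (k * k) (k * 1) (k * d) (k * e) (k * f)"
    "span_condition 0 0 0 (k * 1) (k * 0) (k * 0) (k * 0)"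
    "span_condition 0 0 0 (k * 0) (k * 1) (k * 0) (k * 0)"
    "span_condition 0 0 0 (k * 0) (k * 0) (k * 1) (k * 0)"
    "span_condition 0 0 0 (k * 0) (k * 0) (k * 0) (k * 1)"
    by (simp_all add: span_condition_def mult_ac)
  ultimately have "\<exists>s t u. span_condition s t u (k * w ! 0) (k * w ! 1) (k * w ! 2) (k * w ! 3)"
    using assms unfolding W_def append.simps list.set by (elim insertE emptyE) (simp_all, blast+)
  then show ?thesis using that by blast
qed

lemma octad_mat_carrier: "octad_mat \<in> carrier_mat 4 8"
  by (simp add: octad_mat_def cols_mat_carrier)

lemma octad_mat_point_iff:
  assumes "z \<in> carrier_vec 4"
  shows "(\<exists>j<8. \<exists>k. z = k \<cdot>\<^sub>v col octad_mat j) \<longleftrightarrow>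
    (\<exists>w\<in>set (W @ [[v 1, v 2, v 3, v 4]]). \<exists>k.
      z $ 0 = k * w ! 0 \<and> z $ 1 = k * w ! 1 \<and> z $ 2 = k * w ! 2 \<and> z $ 3 = k * w ! 3)"
  unfolding ex_less_eight octad_mat_def
  by (simp add: col_cols_mat W_def vec4_proportional[OF assms])

lemma octad_zeros:
  assumes "z \<in> carrier_vec 4"
  shows "quad_form q23 z = 0 \<and> quad_form q24 z = 0 \<and> quad_form q34 z = 0 \<longleftrightarrow>
    (\<exists>j<8. \<exists>k. z = k \<cdot>\<^sub>v col octad_mat j)"
  unfolding octad_mat_point_iff[OF assms]
proof
  assume "quad_form q23 z = 0 \<and> quad_form q24 z = 0 \<and> quad_form q34 z = 0"
  then obtain s t u where "span_condition s t u (z $ 0) (z $ 1) (z $ 2) (z $ 3)"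
    using quadrics_imp_span_condition[OF \<Delta>_nz] by metis
  then show "\<exists>w\<in>set (W @ [[v 1, v 2, v 3, v 4]]). \<exists>k.
      z $ 0 = k * w ! 0 \<and> z $ 1 = k * w ! 1 \<and> z $ 2 = k * w ! 2 \<and> z $ 3 = k * w ! 3"
    by (rule span_condition_imp_point)
next
  assume "\<exists>w\<in>set (W @ [[v 1, v 2, v 3, v 4]]). \<exists>k.
      z $ 0 = k * w ! 0 \<and> z $ 1 = k * w ! 1 \<and> z $ 2 = k * w ! 2 \<and> z $ 3 = k * w ! 3"
  then obtain s t u where "span_condition s t u (z $ 0) (z $ 1) (z $ 2) (z $ 3)"
    using point_imp_span_condition by metis
  then show "quad_form q23 z = 0 \<and> quad_form q24 z = 0 \<and> quad_form q34 z = 0"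
    using span_condition_imp_quadrics by blast
qed

lemma octad_mat_all_nonzero: "all_nonzero 4 8 (plucker 4 8 octad_mat)"
  using octad_vector_all_nonzero[OF p_nz] x_nz octad_vector_plucker by (simp add: x_def)

lemma cayley_octad_octad_mat: "cayley_octad octad_mat"
proof -
  note not_prop = columns_not_proportional[OF octad_mat_carrier octad_mat_all_nonzero]
  have "col octad_mat j \<noteq> 0\<^sub>v 4" if "j < 8" for j
  proof
    assume "col octad_mat j = 0\<^sub>v 4"
    moreover obtain k :: nat where "k < 8" "k \<noteq> j" by (metis zero_less_numeral one_less_numeral_iff semiring_norm(76) zero_neq_one)
    moreover have "(0::'a) \<cdot>\<^sub>v col octad_mat k = 0\<^sub>v 4"
      using octad_mat_carrier by (intro eq_vecI) auto
    ultimately show False using not_prop[of k j 0] that by simp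
  qed
  moreover have "\<nexists>s. col octad_mat k = s \<cdot>\<^sub>v col octad_mat j" if "j < 8" "k < 8" "j \<noteq> k" for j k
    using not_prop[OF that] by blast
  ultimately show ?thesis
    unfolding cayley_octad_def
    using octad_mat_carrier quadric_independent[OF \<Delta>_nz] octad_zeros by blast
qed

end

subsection \<open>Reduction to the normal form\<close>

lemma mat_inverse_of_det:
  fixes H :: "'a::field mat"
  assumes "H \<in> carrier_mat n n" "det H \<noteq> 0"
  obtains G where "G \<in> carrier_mat n n" "G * H = 1\<^sub>m n" "H * G = 1\<^sub>m n"
  using det_non_zero_imp_unit[OF assms, of "()"] unfolding Units_def ring_mat_def by auto

lemma cols_mat_mult_index:
  assumes "h \<in> carrier_mat 4 4" "i < 4" "j < m"
  shows "(h * cols_mat m L) $$ (i, j) = (\<Sum>r<4. h $$ (i, r) * L ! j ! r)"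
  using assms by (simp add: cols_mat_def scalar_prod_def atLeast0LessThan)

lemma det4_cong:
  assumes "\<And>i. i < 4 \<Longrightarrow> w i = w' i"
  shows "det4 x y z w = det4 x y z w'"
  using assms by (simp add: det4_def)

text \<open>Cramer's rule with the combination always in last place; the signs come from moving it
  there from the slot of the omitted column.\<close>

lemma det4_cramer:
  fixes x y z t :: "nat \<Rightarrow> 'a::comm_ring_1" and c0 c1 c2 c3 :: 'a
  defines "w \<equiv> \<lambda>i. x i * c0 + y i * c1 + z i * c2 + t i * c3"
  shows "det4 y z t w = - (c0 * det4 x y z t)" "det4 x z t w = c1 * det4 x y z t"
    "det4 x y t w = - (c2 * det4 x y z t)" "det4 x y z w = c3 * det4 x y z t"
  unfolding w_def det4_def by (simp_all add: algebra_simps)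

text \<open>The points 1 to 4 serve as a basis. By Cramer's rule the coordinates
  \<open>C r j\<close> of the other points are quotients of Plucker coordinates up to sign, hence
  nonzero, and may be divided by.\<close>

lemma normal_form_exists:
  fixes B :: "'a::field mat"
  assumes B: "B \<in> carrier_mat 4 7" and nz: "all_nonzero 4 7 (plucker 4 7 B)"
  obtains h l a b c d e f where "h \<in> carrier_mat 4 4" "det h \<noteq> 0" "l \<in> torus 7"
    "\<And>i j. i < 4 \<Longrightarrow> j < 7 \<Longrightarrow> B $$ (i, j) = l (Suc j) * (h * cols_mat 7 (normal_form.W a b c d e f)) $$ (i, j)"
proof -
  have pl: "plucker 4 7 B {i, j, k, l} \<noteq> 0" if "0 < i" "i < j" "j < k" "k < l" "l \<le> 7" for i j k l
    using nz that card_four[of i j k l] unfolding all_nonzero_def by auto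
  define H where "H = mat 4 4 (\<lambda>(i, j). B $$ (i, j))"
  have H: "H \<in> carrier_mat 4 4" by (simp add: H_def)
  define D where "D = det4 (\<lambda>i. B $$ (i, 0)) (\<lambda>i. B $$ (i, 1)) (\<lambda>i. B $$ (i, 2)) (\<lambda>i. B $$ (i, 3))"
  have D: "D \<noteq> 0" using pl[of 1 2 3 4] by (simp add: plucker_four D_def)
  moreover have "det H = D" by (simp add: H_def det_mat4 D_def)
  ultimately obtain G where G: "G \<in> carrier_mat 4 4" "H * G = 1\<^sub>m 4"
    using mat_inverse_of_det[OF H] by metis
  define C where "C = (\<lambda>r j. (G *\<^sub>v col B j) $ r)"
  have BC: "B $$ (i, j) = B $$ (i, 0) * C 0 j + B $$ (i, 1) * C 1 j + B $$ (i, 2) * C 2 j + B $$ (i, 3) * C 3 j"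
    if "i < 4" "j < 7" for i j
  proof -
    have "H *\<^sub>v (G *\<^sub>v col B j) = col B j"
      using G H B by (simp add: assoc_mult_mat_vec[symmetric, of _ 4 4 _ 4] carrier_vecI)
    then have "col B j $ i = (H *\<^sub>v (G *\<^sub>v col B j)) $ i" by simp
    also have "\<dots> = (\<Sum>r<4. H $$ (i, r) * C r j)"
      using that H G by (simp add: scalar_prod_def C_def atLeast0LessThan)
    finally show ?thesis
      using that B by (simp add: H_def sum_lessThan_four)
  qed
  have Cnz: "C r j \<noteq> 0" if "r < 4" "3 < j" "j < 7" for r j
  proof -
    note cramer = det4_cramer[where x = "\<lambda>i. B $$ (i, 0)" and y = "\<lambda>i. B $$ (i, 1)"
        and z = "\<lambda>i. B $$ (i, 2)" and t = "\<lambda>i. B $$ (i, 3)"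
        and ?c0.0 = "C 0 j" and ?c1.0 = "C 1 j" and ?c2.0 = "C 2 j" and ?c3.0 = "C 3 j", folded D_def]
    have col: "det4 s t u (\<lambda>i. B $$ (i, j)) = det4 s t u (\<lambda>i. B $$ (i, 0) * C 0 j + B $$ (i, 1) * C 1 j +
        B $$ (i, 2) * C 2 j + B $$ (i, 3) * C 3 j)" for s t u
      by (rule det4_cong, rule BC) (use that in simp_all)
    have "plucker 4 7 B {2, 3, 4, Suc j} = - (C 0 j * D)" "plucker 4 7 B {1, 3, 4, Suc j} = C 1 j * D"
      "plucker 4 7 B {1, 2, 4, Suc j} = - (C 2 j * D)" "plucker 4 7 B {1, 2, 3, Suc j} = C 3 j * D"
      using that cramer by (simp_all add: plucker_four col)
    moreover have "plucker 4 7 B {2, 3, 4, Suc j} \<noteq> 0" "plucker 4 7 B {1, 3, 4, Suc j} \<noteq> 0"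
      "plucker 4 7 B {1, 2, 4, Suc j} \<noteq> 0" "plucker 4 7 B {1, 2, 3, Suc j} \<noteq> 0"
      using that by (intro pl; simp)+
    moreover have "r = 0 \<or> r = 1 \<or> r = 2 \<or> r = 3" using that by auto
    ultimately show ?thesis by auto
  qed
  \<comment> \<open>Scaling the basis by the coordinates of point 5 makes that point (1, 1, 1,
    1).\<close>
  define h where "h = mat 4 4 (\<lambda>(i, r). B $$ (i, r) * C r 4)"
  have h: "h \<in> carrier_mat 4 4" by (simp add: h_def)
  have "det h = C 0 4 * C 1 4 * C 2 4 * C 3 4 * D"
    by (simp add: h_def det_mat4 D_def det4_def, simp add: algebra_simps)
  then have "det h \<noteq> 0" using D Cnz by simp
  \<comment> \<open>The weights undo the scaling of the points 1 to 4 and restore the first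
    coordinate, normalised to 1, of the points 5 to 7.\<close>
  define l where "l = (\<lambda>n. if n \<le> 4 then 1 / C (n - 1) 4 else C 0 (n - 1) / C 0 4)"
  have "l \<in> torus 7" using Cnz by (auto simp: torus_def l_def)
  define N where "N = (\<lambda>r j. C r j * C 0 4 / (C r 4 * C 0 j))"
  let ?W = "normal_form.W (N 1 5) (N 2 5) (N 3 5) (N 1 6) (N 2 6) (N 3 6)"
  have "B $$ (i, j) = l (Suc j) * (h * cols_mat 7 ?W) $$ (i, j)" if ij: "i < 4" "j < 7" for i j
  proof (cases "j < 4")
    case True
    then have "j = 0 \<or> j = 1 \<or> j = 2 \<or> j = 3" by auto
    then show ?thesis
      unfolding cols_mat_mult_index[OF h ij] sum_lessThan_four
      using ij Cnz by (elim disjE) (simp_all add: normal_form.W_def l_def h_def)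
  next
    case False
    have W: "?W ! j ! r = N r j" if "r < 4" for r
    proof -
      have "j = 4 \<or> j = 5 \<or> j = 6" "r = 0 \<or> r = 1 \<or> r = 2 \<or> r = 3"
        using that ij False by auto
      then show ?thesis
        using Cnz by (elim disjE) (simp_all add: normal_form.W_def N_def)
    qed
    have scale: "C 0 j / C 0 4 * (B $$ (i, r) * C r 4 * N r j) = B $$ (i, r) * C r j" if "r < 4" for r
      using that False ij Cnz[of r 4] Cnz[of 0 4] Cnz[of 0 j] by (simp add: N_def)
    have "l (Suc j) * (h * cols_mat 7 ?W) $$ (i, j) =
        (\<Sum>r<4. C 0 j / C 0 4 * (B $$ (i, r) * C r 4 * N r j))"
      unfolding cols_mat_mult_index[OF h ij] sum_distrib_left
      using ij False by (intro sum.cong refl) (simp add: W l_def h_def del: One_nat_def)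
    also have "\<dots> = (\<Sum>r<4. B $$ (i, r) * C r j)"
      by (intro sum.cong refl scale) simp
    finally show ?thesis using BC[OF ij] by (simp add: sum_lessThan_four)
  qed
  then show ?thesis using that[OF h \<open>det h \<noteq> 0\<close> \<open>l \<in> torus 7\<close>] by blast
qed

text \<open>The parameters are, up to sign, the coordinates with three indices among 1 to 4 and the
  fourth index 6 or 7. The coordinates normalised to 1 or -1 in both forms force the scaling factor
  of each of these to be 1.\<close>

lemma normal_form_unique:
  assumes eq: "normal_form.p a' b' c' d' e' f' = scaled k l (normal_form.p a b c d e f)"
  shows "a' = a \<and> b' = b \<and> c' = c \<and> d' = d \<and> e' = e \<and> f' = f"
proof -
  have at: "normal_form.p a' b' c' d' e' f' I = k * (\<Prod>i\<in>I. l i) * normal_form.p a b c d e f I" for I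
    using fun_cong[OF eq, of I] by (simp add: scaled_apply mult.assoc)
  have prods: "(\<Prod>i\<in>{1, 2, 3, n}. l i) = l 1 * l 2 * l 3 * l n" "(\<Prod>i\<in>{1, 2, 4, n}. l i) = l 1 * l 2 * l 4 * l n"
    "(\<Prod>i\<in>{1, 3, 4, n}. l i) = l 1 * l 3 * l 4 * l n" "(\<Prod>i\<in>{2, 3, 4, n}. l i) = l 2 * l 3 * l 4 * l n"
    if "4 < n" for n
    using that by (simp_all add: mult_ac)
  note p = normal_form.p_eqs
  have 5: "k * (l 1 * l 2 * l 3 * l 5) = 1" "k * (l 1 * l 2 * l 4 * l 5) = 1"
    "k * (l 1 * l 3 * l 4 * l 5) = 1" "k * (l 2 * l 3 * l 4 * l 5) = 1"
    using at[of "{1, 2, 3, 5}"] at[of "{1, 2, 4, 5}"] at[of "{1, 3, 4, 5}"] at[of "{2, 3, 4, 5}"]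
    unfolding p by (simp_all add: prods[of 5, simplified] mult.assoc)
  \<comment> \<open>For point \<open>n\<close> only the factor of \<open>{2, 3, 4, n}\<close> is
    known at first; multiplicativity of the torus action and the factors for point 5 give the other
    three.\<close>
  have step: "k * (l 1 * l 2 * l 3 * l n) = 1 \<and> k * (l 1 * l 2 * l 4 * l n) = 1 \<and> k * (l 1 * l 3 * l 4 * l n) = 1"
    if n: "k * (l 2 * l 3 * l 4 * l n) = 1" for n
  proof -
    have "k * (l 1 * l 2 * l 3 * l n) * (k * (l 2 * l 3 * l 4 * l 5)) = k * (l 2 * l 3 * l 4 * l n) * (k * (l 1 * l 2 * l 3 * l 5))"
      "k * (l 1 * l 2 * l 4 * l n) * (k * (l 2 * l 3 * l 4 * l 5)) = k * (l 2 * l 3 * l 4 * l n) * (k * (l 1 * l 2 * l 4 * l 5))"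
      "k * (l 1 * l 3 * l 4 * l n) * (k * (l 2 * l 3 * l 4 * l 5)) = k * (l 2 * l 3 * l 4 * l n) * (k * (l 1 * l 3 * l 4 * l 5))"
      by (simp_all only: mult_ac)
    then show ?thesis unfolding 5 n by simp
  qed
  have "k * (l 2 * l 3 * l 4 * l 6) = 1" "k * (l 2 * l 3 * l 4 * l 7) = 1"
    using at[of "{2, 3, 4, 6}"] at[of "{2, 3, 4, 7}"] unfolding p
    by (simp_all add: prods[of 6, simplified] prods[of 7, simplified] mult.assoc)
  from step[OF this(1)] step[OF this(2)] show ?thesis
    using at[of "{1, 2, 3, 6}"] at[of "{1, 2, 4, 6}"] at[of "{1, 3, 4, 6}"]
      at[of "{1, 2, 3, 7}"] at[of "{1, 2, 4, 7}"] at[of "{1, 3, 4, 7}"] prods[of 6] prods[of 7]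
    by (simp add: p mult.assoc del: One_nat_def)
qed

section \<open>Uniqueness of the octad through seven given points\<close>

context general_normal_form
begin

lemma W_append_nth: "j < 7 \<Longrightarrow> (W @ [w]) ! j = W ! j"
  by (subst nth_append) (simp add: W_def)

text \<open>Pulled back along \<open>h\<close>, the three quadrics of \<open>A\<close> are
  combinations of \<open>q23\<close>, \<open>q24\<close>, \<open>q34\<close>. Their independence
  makes the coefficient matrix invertible, so the pulled back eighth column is also a zero of
  \<open>q23\<close>, \<open>q24\<close>, \<open>q34\<close>. By \<open>octad_zeros\<close> it is
  one of eight points, and not one of the first seven because the columns of \<open>A\<close> are
  pairwise non-proportional.\<close>

lemma octad_unique:
  assumes oct: "cayley_octad A" and h: "h \<in> carrier_mat 4 4" "det h \<noteq> 0" and l: "l \<in> torus 7"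
    and A_eq: "\<And>i j. i < 4 \<Longrightarrow> j < 7 \<Longrightarrow> A $$ (i, j) = l (Suc j) * (h * cols_mat 7 W) $$ (i, j)"
  shows "torus_orbit 8 (plucker 4 8 A) = torus_orbit 8 (octad_vector p)"
proof -
  have A: "A \<in> carrier_mat 4 8" and A0: "\<And>j. j < 8 \<Longrightarrow> col A j \<noteq> 0\<^sub>v 4"
    and A_prop: "\<And>j k s. j < 8 \<Longrightarrow> k < 8 \<Longrightarrow> j \<noteq> k \<Longrightarrow> col A k \<noteq> s \<cdot>\<^sub>v col A j"
    using oct unfolding cayley_octad_def by auto
  have "\<exists>a b c.
      (\<forall>r s t. (\<forall>i<4. \<forall>j\<in>{i..<4}. r * a i j + s * b i j + t * c i j = 0) \<longrightarrow> r = 0 \<and> s = 0 \<and> t = 0) \<and>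
      (\<forall>x\<in>carrier_vec 4. x \<noteq> 0\<^sub>v 4 \<longrightarrow>
        (quad_form a x = 0 \<and> quad_form b x = 0 \<and> quad_form c x = 0 \<longleftrightarrow> (\<exists>j<8. \<exists>s. x = s \<cdot>\<^sub>v col A j)))"
    using oct unfolding cayley_octad_def by (elim conjE)
  then obtain qa qb qc where q:
    "(\<forall>r s t. (\<forall>i<4. \<forall>j\<in>{i..<4}. r * qa i j + s * qb i j + t * qc i j = 0) \<longrightarrow> r = 0 \<and> s = 0 \<and> t = 0) \<and>
      (\<forall>x\<in>carrier_vec 4. x \<noteq> 0\<^sub>v 4 \<longrightarrow>
        (quad_form qa x = 0 \<and> quad_form qb x = 0 \<and> quad_form qc x = 0 \<longleftrightarrow> (\<exists>j<8. \<exists>s. x = s \<cdot>\<^sub>v col A j)))"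
    by (elim exE) (rule that)
  note indep = q[THEN conjunct1, THEN spec, THEN spec, THEN spec, THEN mp]
  note zeros = q[THEN conjunct2, THEN bspec, THEN mp]
  have colA: "col A j \<in> carrier_vec 4" for j using A by (simp add: carrier_vecI)
  have vanish: "quad_form qa (col A j) = 0" "quad_form qb (col A j) = 0" "quad_form qc (col A j) = 0"
    if "j < 8" for j
  proof -
    have "col A j = 1 \<cdot>\<^sub>v col A j" by simp
    then show "quad_form qa (col A j) = 0" "quad_form qb (col A j) = 0" "quad_form qc (col A j) = 0"
      using zeros[OF colA A0[OF that]] that by metis+
  qed
  obtain g where g: "g \<in> carrier_mat 4 4" "g * h = 1\<^sub>m 4" "h * g = 1\<^sub>m 4"
    using mat_inverse_of_det[OF h] by metis
  have hg: "h *\<^sub>v (g *\<^sub>v z) = z" if "z \<in> carrier_vec 4" for z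
    using that g h by (simp add: assoc_mult_mat_vec[symmetric, of _ 4 4 _ 4])
  have gz: "g *\<^sub>v z \<in> carrier_vec 4" if "z \<in> carrier_vec 4" for z
    using g(1) that by simp
  obtain qa' where qa': "\<And>z. z \<in> carrier_vec 4 \<Longrightarrow> quad_form qa (h *\<^sub>v z) = quad_form qa' z"
    using quad_form_pullback[OF h(1)] by metis
  obtain qb' where qb': "\<And>z. z \<in> carrier_vec 4 \<Longrightarrow> quad_form qb (h *\<^sub>v z) = quad_form qb' z"
    using quad_form_pullback[OF h(1)] by metis
  obtain qc' where qc': "\<And>z. z \<in> carrier_vec 4 \<Longrightarrow> quad_form qc (h *\<^sub>v z) = quad_form qc' z"
    using quad_form_pullback[OF h(1)] by metis
  let ?w = "\<lambda>j. vec 4 ((!) (W ! j))"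
  have l_nz: "l (Suc j) \<noteq> 0" if "j < 7" for j using l that by (auto simp: torus_def)
  have col: "col A j = l (Suc j) \<cdot>\<^sub>v (h *\<^sub>v ?w j)" if "j < 7" for j
  proof (rule eq_vecI)
    fix i assume "i < dim_vec (l (Suc j) \<cdot>\<^sub>v (h *\<^sub>v ?w j))"
    then have i: "i < 4" using h by simp
    have "(h * cols_mat 7 W) $$ (i, j) = row h i \<bullet> ?w j"
      using i that h by (simp add: cols_mat_carrier[THEN carrier_matD(2)] col_cols_mat)
    then show "col A j $ i = (l (Suc j) \<cdot>\<^sub>v (h *\<^sub>v ?w j)) $ i"
      using A_eq[OF i that] i that h A by simp
  qed (use A h in simp)
  have w: "?w j \<in> carrier_vec 4" for j by simp
  have pulled: "quad_form q' (?w j) = 0"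
    if "\<And>z. z \<in> carrier_vec 4 \<Longrightarrow> quad_form q (h *\<^sub>v z) = quad_form q' z" "quad_form q (col A j) = 0" "j < 7"
    for q q' :: "nat \<Rightarrow> nat \<Rightarrow> 'a" and j
  proof -
    have "h *\<^sub>v ?w j \<in> carrier_vec 4" using h by simp
    then have "l (Suc j) * l (Suc j) * quad_form q (h *\<^sub>v ?w j) = 0"
      using that(2) unfolding col[OF that(3)] by (simp add: quad_form_smult)
    then show ?thesis using l_nz[OF that(3)] that(1)[OF w] by simp
  qed
  have qa0: "quad_form qa' (?w j) = 0" if "j < 7" for j
    by (rule pulled[OF qa' _ that]) (use vanish that in simp_all)
  have qb0: "quad_form qb' (?w j) = 0" if "j < 7" for j
    by (rule pulled[OF qb' _ that]) (use vanish that in simp_all)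
  have qc0: "quad_form qc' (?w j) = 0" if "j < 7" for j
    by (rule pulled[OF qc' _ that]) (use vanish that in simp_all)
  have qa_eq: "\<Delta> * quad_form qa' z = qa' 1 2 * quad_form q23 z + qa' 1 3 * quad_form q24 z + qa' 2 3 * quad_form q34 z" for z
    by (rule quad_form_through_points) (rule qa0)
  have qb_eq: "\<Delta> * quad_form qb' z = qb' 1 2 * quad_form q23 z + qb' 1 3 * quad_form q24 z + qb' 2 3 * quad_form q34 z" for z
    by (rule quad_form_through_points) (rule qb0)
  have qc_eq: "\<Delta> * quad_form qc' z = qc' 1 2 * quad_form q23 z + qc' 1 3 * quad_form q24 z + qc' 2 3 * quad_form q34 z" for z
    by (rule quad_form_through_points) (rule qc0)
  define w' where "w' = g *\<^sub>v col A 7"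
  have w': "w' \<in> carrier_vec 4" "h *\<^sub>v w' = col A 7" using gz hg colA by (simp_all add: w'_def)
  define M where "M = (\<lambda>i j. [[qa' 1 2, qa' 1 3, qa' 2 3], [qb' 1 2, qb' 1 3, qb' 2 3], [qc' 1 2, qc' 1 3, qc' 2 3]] ! i ! j)"
  define y where "y = (!) [quad_form q23 w', quad_form q24 w', quad_form q34 w']"
  have sum3: "(\<Sum>j<3. F j) = F 0 + F 1 + (F 2 :: 'a)" for F :: "nat \<Rightarrow> 'a"
    by (simp add: eval_nat_numeral)
  have "y j = 0" if "j < 3" for j
  proof (rule left_kernel_trivial_imp_right[of 3 M y j])
    fix r :: "nat \<Rightarrow> 'a" assume r: "\<And>j. j < 3 \<Longrightarrow> (\<Sum>i<3. r i * M i j) = 0"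
    have r: "r 0 * qa' 1 2 + r 1 * qb' 1 2 + r 2 * qc' 1 2 = 0"
      "r 0 * qa' 1 3 + r 1 * qb' 1 3 + r 2 * qc' 1 3 = 0"
      "r 0 * qa' 2 3 + r 1 * qb' 2 3 + r 2 * qc' 2 3 = 0"
      using r[of 0] r[of 1] r[of 2] by (simp_all add: sum3 M_def)
    have "r 0 * quad_form qa' z + r 1 * quad_form qb' z + r 2 * quad_form qc' z = 0" for z
    proof -
      have "\<Delta> * (r 0 * quad_form qa' z + r 1 * quad_form qb' z + r 2 * quad_form qc' z) =
          r 0 * (\<Delta> * quad_form qa' z) + r 1 * (\<Delta> * quad_form qb' z) + r 2 * (\<Delta> * quad_form qc' z)"
        by (simp only: distrib_left mult.left_commute[of "\<Delta>"])
      also have "\<dots> = (r 0 * qa' 1 2 + r 1 * qb' 1 2 + r 2 * qc' 1 2) * quad_form q23 z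
        + (r 0 * qa' 1 3 + r 1 * qb' 1 3 + r 2 * qc' 1 3) * quad_form q24 z
        + (r 0 * qa' 2 3 + r 1 * qb' 2 3 + r 2 * qc' 2 3) * quad_form q34 z"
        unfolding qa_eq qb_eq qc_eq by (simp only: distrib_left distrib_right mult.assoc add_ac)
      also have "\<dots> = 0" unfolding r by simp
      finally show ?thesis using \<Delta>_nz by (simp only: mult_eq_0_iff) blast
    qed
    \<comment> \<open>Evaluating at \<open>g *\<^sub>v z\<close> undoes the pullback, so the same
      combination of the original quadrics vanishes everywhere and their independence
      applies.\<close>
    then have "quad_form (\<lambda>i j. r 0 * qa i j + r 1 * qb i j + r 2 * qc i j) z = 0" if "z \<in> carrier_vec 4" for z
      using qa'[OF gz[OF that]] qb'[OF gz[OF that]] qc'[OF gz[OF that]] hg[OF that]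
      by (simp add: quad_form_linear)
    then have "r 0 * qa i j + r 1 * qb i j + r 2 * qc i j = 0" if "i \<le> j" "j < 4" for i j
      using quad_form_zero_coeffs[of "\<lambda>i j. r 0 * qa i j + r 1 * qb i j + r 2 * qc i j" i j] that by blast
    then have "r 0 = 0 \<and> r 1 = 0 \<and> r 2 = 0" by (intro indep) auto
    then show "\<forall>i<3. r i = 0" by (auto simp: less_Suc_eq eval_nat_numeral)
  next
    fix i :: nat assume "i < 3"
    then have i: "i = 0 \<or> i = 1 \<or> i = 2" by auto
    have "quad_form qa' w' = 0" "quad_form qb' w' = 0" "quad_form qc' w' = 0"
      using vanish[of 7] qa'[OF w'(1)] qb'[OF w'(1)] qc'[OF w'(1)] w'(2) by simp_all
    then have "qa' 1 2 * quad_form q23 w' + qa' 1 3 * quad_form q24 w' + qa' 2 3 * quad_form q34 w' = 0"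
      "qb' 1 2 * quad_form q23 w' + qb' 1 3 * quad_form q24 w' + qb' 2 3 * quad_form q34 w' = 0"
      "qc' 1 2 * quad_form q23 w' + qc' 1 3 * quad_form q24 w' + qc' 2 3 * quad_form q34 w' = 0"
      unfolding qa_eq[symmetric] qb_eq[symmetric] qc_eq[symmetric] by simp_all
    with i show "(\<Sum>j<3. M i j * y j) = 0"
      unfolding sum3 by (elim disjE) (simp_all add: M_def y_def)
  qed (rule that)
  from this[of 0] this[of 1] this[of 2]
  have "quad_form q23 w' = 0 \<and> quad_form q24 w' = 0 \<and> quad_form q34 w' = 0"
    by (simp add: y_def)
  then obtain j k where j: "j < 8" "w' = k \<cdot>\<^sub>v col octad_mat j"
    using octad_zeros[OF w'(1)] by blast
  have colO: "col octad_mat j \<in> carrier_vec 4" for j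
    using octad_mat_carrier by (simp add: carrier_vecI)
  have A7: "col A 7 = k \<cdot>\<^sub>v (h *\<^sub>v col octad_mat j)"
    using w'(2) j(2) h colO by (simp add: mult_mat_vec[of _ 4 4])
  have "j = 7"
  proof (rule ccontr)
    assume "j \<noteq> 7"
    then have j7: "j < 7" using j(1) by simp
    then have "col octad_mat j = ?w j"
      unfolding octad_mat_def using j(1) by (simp add: col_cols_mat W_append_nth)
    then have "col A 7 = (k / l (Suc j)) \<cdot>\<^sub>v col A j"
      unfolding A7 col[OF j7] using l_nz[OF j7] by (simp add: smult_smult_assoc)
    then show False using A_prop[of j 7 "k / l (Suc j)"] j7 by simp
  qed
  note A7 = A7[unfolded this]
  have "k \<noteq> 0"
  proof
    assume "k = 0"
    then have "col A 7 = 0\<^sub>v 4" unfolding A7 using h colO by (intro eq_vecI) auto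
    then show False using A0[of 7] by simp
  qed
  define l' where "l' = l(8 := k)"
  have eight: "i \<in> {1..7}" if "i \<in> {1..8}" "i \<noteq> 8" for i :: nat using that by auto
  have l': "l' \<in> torus 8" using l \<open>k \<noteq> 0\<close> eight unfolding torus_def l'_def by auto
  have colO7: "(h * octad_mat) $$ (i, j) = (h * cols_mat 7 W) $$ (i, j)" if "i < 4" "j < 7" for i j
    using that h unfolding octad_mat_def
    by (simp add: cols_mat_mult_index W_append_nth)
  have "plucker 4 8 A = scaled (det h) l' (plucker 4 8 octad_mat)"
  proof (rule plucker_transform[OF h(1) octad_mat_carrier A])
    fix i j :: nat assume i: "i < 4" and j': "j < 8"
    show "A $$ (i, j) = l' (Suc j) * (h * octad_mat) $$ (i, j)"
    proof (cases "j = 7")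
      case True
      have "col A 7 $ i = k * (row h i \<bullet> col octad_mat 7)"
        using A7 i h by simp
      then show ?thesis
        using True i h A octad_mat_carrier by (simp add: l'_def)
    next
      case False
      then have "j < 7" using j' by simp
      then show ?thesis using A_eq[OF i] colO7[OF i] by (simp add: l'_def)
    qed
  qed
  moreover have "torus_orbit 8 (scaled (det h) l' (plucker 4 8 octad_mat)) = torus_orbit 8 (plucker 4 8 octad_mat)"
    by (rule torus_orbit_scaled[OF h(2) l']) (rule plucker_eq_0)
  ultimately show ?thesis by (simp add: octad_vector_plucker)
qed

text \<open>An octad \<open>A\<close> is only known to have its first seven points in the class.
  Bringing them to normal form could produce other parameters; \<open>normal_form_unique\<close>
  excludes this, so \<open>octad_unique\<close> applies with the given \<open>W\<close>.\<close>

lemma octad_containing_iff: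
  "octad_containing (torus_orbit 7 p) D \<longleftrightarrow> D = torus_orbit 8 (octad_vector p)"
proof
  assume "D = torus_orbit 8 (octad_vector p)"
  moreover have "mat 4 7 (\<lambda>(i, j). octad_mat $$ (i, j)) = cols_mat 7 W"
    by (rule eq_matI) (simp_all add: octad_mat_def cols_mat_def W_append_nth)
  ultimately show "octad_containing (torus_orbit 7 p) D"
    unfolding octad_containing_def
    using cayley_octad_octad_mat octad_vector_plucker torus_orbit_self[of p 7]
    by (intro exI[of _ octad_mat]) (simp add: p_def)
next
  assume "octad_containing (torus_orbit 7 p) D"
  then obtain A where oct: "cayley_octad A" and D: "D = torus_orbit 8 (plucker 4 8 A)"
    and orb: "plucker 4 7 (mat 4 7 (\<lambda>(i, j). A $$ (i, j))) \<in> torus_orbit 7 p"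
    unfolding octad_containing_def by blast
  let ?B = "mat 4 7 (\<lambda>(i, j). A $$ (i, j))"
  obtain k l where kl: "k \<noteq> 0" "l \<in> torus 7" "plucker 4 7 ?B = scaled k l p"
    using orb unfolding torus_orbit_iff by blast
  have "all_nonzero 4 7 (plucker 4 7 ?B)"
    using p_nz scaled_eq_0_iff[OF kl(1,2)] unfolding kl(3) all_nonzero_def by blast
  then obtain h m a' b' c' d' e' f' where h: "h \<in> carrier_mat 4 4" "det h \<noteq> 0" "m \<in> torus 7"
    and B: "\<And>i j. i < 4 \<Longrightarrow> j < 7 \<Longrightarrow>
      ?B $$ (i, j) = m (Suc j) * (h * cols_mat 7 (normal_form.W a' b' c' d' e' f')) $$ (i, j)"
    using normal_form_exists[of ?B] mat_carrier by metis
  have "plucker 4 7 ?B = scaled (det h) m (normal_form.p a' b' c' d' e' f')"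
    unfolding normal_form.p_def
    by (rule plucker_transform[OF h(1) cols_mat_carrier _ B]) simp_all
  then have "scaled (inverse (det h)) (\<lambda>i. inverse (m i)) (scaled k l p) = normal_form.p a' b' c' d' e' f'"
    unfolding kl(3)[symmetric]
    by (simp only:) (rule scaled_inverse[OF h(2,3)], simp add: normal_form.p_def plucker_eq_0)
  then have "a' = a \<and> b' = b \<and> c' = c \<and> d' = d \<and> e' = e \<and> f' = f"
    unfolding scaled_scaled by (intro normal_form_unique) (rule sym)
  then have "A $$ (i, j) = m (Suc j) * (h * cols_mat 7 W) $$ (i, j)" if "i < 4" "j < 7" for i j
    using B[OF that] that by simp
  then show "D = torus_orbit 8 (octad_vector p)"
    unfolding D by (rule octad_unique[OF oct h])
qed

end

text \<open>Both conditions on \<open>p\<close> pass to its normal form because the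
  \<open>octad_x\<close> and the coordinates are only multiplied by nonzero factors; the conclusions
  return because equal orbits result.\<close>

lemma general_point:
  fixes p :: "'a::field coords"
  assumes p: "p \<in> Gr 4 7" and nz: "all_nonzero 4 7 p" and x: "\<And>i. i \<in> {1..7} \<Longrightarrow> octad_x p i \<noteq> 0"
  shows "octad_vector p \<in> SGr 4 8"
    and "octad_containing (torus_orbit 7 p) D \<longleftrightarrow> D = torus_orbit 8 (octad_vector p)"
proof -
  obtain B where B: "B \<in> carrier_mat 4 7" "p = plucker 4 7 B" using p by (auto simp: Gr_def)
  obtain h l a b c d e f where h: "h \<in> carrier_mat 4 4" "det h \<noteq> 0" "l \<in> torus 7"
    and B_eq: "\<And>i j. i < 4 \<Longrightarrow> j < 7 \<Longrightarrow>
      B $$ (i, j) = l (Suc j) * (h * cols_mat 7 (normal_form.W a b c d e f)) $$ (i, j)"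
    using normal_form_exists[OF B(1)] nz B(2) by metis
  define q where "q = normal_form.p a b c d e f"
  have pq: "p = scaled (det h) l q"
    unfolding B(2) q_def normal_form.p_def
    by (rule plucker_transform[OF h(1) cols_mat_carrier B(1) B_eq])
  have q0: "q I = 0" if "\<not> I \<subseteq> {1..7}" for I
    using that plucker_eq_0 by (simp add: q_def normal_form.p_def)
  interpret general_normal_form a b c d e f
  proof
    show "normal_form.x a b c d e f i \<noteq> 0" if "i \<in> {1..7}" for i
      using x[OF that] octad_x_scaled[OF that, of "det h" l q]
      by (auto simp: pq normal_form.x_def q_def)
    show "all_nonzero 4 7 (normal_form.p a b c d e f)"
      using nz scaled_eq_0_iff[OF h(2,3), of _ q] by (auto simp: all_nonzero_def pq q_def)
  qed
  obtain l' where l': "l' \<in> torus 8" "octad_vector p = scaled (det h) l' (octad_vector q)"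
    using octad_vector_scaled(1)[OF h(2,3), of q] octad_vector_scaled(2)[OF h(2,3)] pq by metis
  have "octad_vector q \<in> Gr 4 8"
    unfolding q_def octad_vector_plucker Gr_def
    using octad_mat_carrier octad_mat_all_nonzero card_four[of 1 2 3 4]
    by (auto simp: all_nonzero_def intro!: exI[of _ "{1, 2, 3, 4}"])
  then have "octad_vector p \<in> Gr 4 8" unfolding l'(2) by (rule Gr_scaled) (use h l' in simp_all)
  then show "octad_vector p \<in> SGr 4 8"
    using octad_vector_self_dual[of p] x by (simp add: SGr_def)
  have "torus_orbit 7 p = torus_orbit 7 q"
    unfolding pq by (rule torus_orbit_scaled[OF h(2,3)]) (rule q0)
  moreover have "torus_orbit 8 (octad_vector p) = torus_orbit 8 (octad_vector q)"
    unfolding l'(2) by (rule torus_orbit_scaled[OF h(2) l'(1)]) (rule octad_vector_eq_0)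
  ultimately show "octad_containing (torus_orbit 7 p) D \<longleftrightarrow> D = torus_orbit 8 (octad_vector p)"
    using octad_containing_iff by (simp add: q_def)
qed

theorem theorem2p7:
  assumes "infinite (UNIV :: 'a::field set)"
  shows "for_general (Gr 4 7 :: 'a coords set)
    (\<lambda>p. (\<forall>i\<in>{1..7}. octad_x p i \<noteq> 0) \<and>
         octad_vector p \<in> SGr 4 8 \<and>
         torus_orbit 7 p \<in> config_space 4 7 \<and>
         torus_orbit 8 (octad_vector p) \<in> sd_config_space 4 \<and>
         (\<exists>!D. octad_containing (torus_orbit 7 p) D) \<and>
         cayley_octad_map (torus_orbit 7 p) = torus_orbit 8 (octad_vector p))"
proof -
  let ?S = "{I. I \<subseteq> {1..7::nat} \<and> card I = 4}"
  let ?F = "\<lambda>p::'a coords. (\<Prod>I\<in>?S. p I) * (\<Prod>i\<in>{1..7}. octad_x p i)"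
  have fin: "finite ?S" by simp
  have "pl_nonzero 7 (\<lambda>p::'a coords. \<Prod>I\<in>?S. p I)"
    by (rule pl_nonzero_prod[OF assms fin]) (rule pl_nonzero_coord; blast)
  moreover have "pl_nonzero 7 (\<lambda>p::'a coords. \<Prod>i\<in>{1..7}. octad_x p i)"
    by (rule pl_nonzero_prod[OF assms finite_atLeastAtMost]) (rule pl_nonzero_octad_x)
  ultimately have F: "pl_nonzero 7 ?F" by (rule pl_nonzero_mult[OF assms])
  show ?thesis
  proof (rule for_general_GrI[OF assms F])
    have "{1, 2, 3, 4} \<in> ?S" using card_four[of 1 2 3 4] by auto
    then have "(\<Prod>I\<in>?S. 0) = (0::'a)" using fin by (intro prod_zero bexI[of _ "{1, 2, 3, 4}"]) auto
    then show "?F (\<lambda>I. 0) = 0" by simp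
  next
    fix p :: "'a coords" assume p: "p \<in> Gr 4 7" and "?F p \<noteq> 0"
    then have nz: "all_nonzero 4 7 p" and x: "\<And>i. i \<in> {1..7} \<Longrightarrow> octad_x p i \<noteq> 0"
      using fin by (auto simp: all_nonzero_def)
    have D: "octad_containing (torus_orbit 7 p) D \<longleftrightarrow> D = torus_orbit 8 (octad_vector p)" for D
      by (rule general_point(2)[OF p nz]) (rule x)
    have "all_nonzero 4 8 (octad_vector p)" using octad_vector_all_nonzero[OF nz x] .
    then have "torus_orbit 8 (octad_vector p) \<in> sd_config_space 4"
      using general_point(1)[OF p nz x] unfolding sd_config_space_def by simp
    moreover have "torus_orbit 7 p \<in> config_space 4 7"
      using p nz unfolding config_space_def by blast
    moreover have "\<exists>!D. octad_containing (torus_orbit 7 p) D" by (simp add: D)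
    moreover have "cayley_octad_map (torus_orbit 7 p) = torus_orbit 8 (octad_vector p)"
      unfolding cayley_octad_map_def by (rule the_equality) (simp_all add: D)
    ultimately show "(\<forall>i\<in>{1..7}. octad_x p i \<noteq> 0) \<and> octad_vector p \<in> SGr 4 8 \<and>
         torus_orbit 7 p \<in> config_space 4 7 \<and>
         torus_orbit 8 (octad_vector p) \<in> sd_config_space 4 \<and>
         (\<exists>!D. octad_containing (torus_orbit 7 p) D) \<and>
         cayley_octad_map (torus_orbit 7 p) = torus_orbit 8 (octad_vector p)"
      using x general_point(1)[OF p nz x] by blast
  qed
qed

end
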